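(* Suppose $s>\frac12$. Then for all $u_0\in H^s_{per}([-\pi,\pi])$ there exist $T=T(\|u_0\|_{H^s_{per}})>0$ and a unique solution $u$, on the time interval $[-T,T]$, of the periodic initial value problem $$u_t+u_x+uu_x+\mathcal{H}u_{xt}=0,\qquad u(x,0)=u_0(x),$$ such that $u\in C([-T,T];H^s_{per}([-\pi,\pi]))$. Furthermore, for all $T'<T$ there exists a neighborhood $V$ of $u_0$ in $H^s_{per}([-\pi,\pi])$ such that the map $$\mathbb{F}:V\longrightarrow C([-T',T'];H^s_{per}([-\pi,\pi])),\qquad \tilde u_0\longmapsto \tilde u(t),$$ sending an initial datum to the corresponding solution, is Lipschitz.
   Context: Functions are $2\pi$-periodic in $x$ and solutions $u$ are real-valued. For a $2\pi$-periodic distribution $f$, $\widehat f(k)=\frac1{2\pi}\int_{-\pi}^{\pi}f(x)e^{-ikx}dx$, $k\in\mathbb{Z}$. $H^s_{per}([-\pi,\pi])$ is the Sobolev space of $2\pi$-periodic distributions with norm $\|f\|_{H^s_{per}}^2=2\pi\sum_{k\in\mathbb{Z}}(1+|k|^2)^s|\widehat f(k)|^2$. $\mathcal{H}$ is the Hilbert transform, $\widehat{\mathcal{H}f}(k)=-i\,\mathrm{sgn}(k)\widehat f(k)$ (so $\mathcal{H}\partial_x$ has Fourier symbol $|k|$). The equation is understood in its integrated form $u(t)=u_0+\int_0^tK(u+\frac12u^2)(\tau)\,d\tau$, where $\widehat{Kv}(n)=\frac{-in}{1+|n|}\widehat v(n)$. *)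

theory Defs
  imports "HOL-Analysis.Analysis"
begin

section \<open>Periodic distributions\<close>

definition vderiv :: "nat \<Rightarrow> (real \<Rightarrow> complex) \<Rightarrow> real \<Rightarrow> complex" where
  "vderiv n \<phi> = ((\<lambda>g x. vector_derivative g (at x)) ^^ n) \<phi>"

definition test_functions :: "(real \<Rightarrow> complex) set" where
  "test_functions =
     {\<phi>. (\<forall>x. \<phi> (x + 2 * pi) = \<phi> x) \<and> (\<forall>n x. vderiv n \<phi> differentiable (at x))}"

text \<open>A periodic distribution is a linear functional \<open>F\<close> on the smooth periodic functions that is
  continuous for the usual Frechet topology, i.e.
  \<open>\<bar>F \<phi>\<bar> \<le> C max\<^sub>j\<^sub>\<le>\<^sub>N sup \<bar>\<phi>\<^sup>(\<^sup>j\<^sup>)\<bar>\<close> for some \<open>C\<close> and \<open>N\<close>. The value \<open>0\<close> outside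
  \<open>test_functions\<close> only serves to make equality of distributions the intended one.\<close>

typedef per_dist =
  "{F :: (real \<Rightarrow> complex) \<Rightarrow> complex.
      (\<forall>\<phi>\<in>test_functions. \<forall>\<psi>\<in>test_functions. F (\<lambda>x. \<phi> x + \<psi> x) = F \<phi> + F \<psi>) \<and>
      (\<forall>c. \<forall>\<phi>\<in>test_functions. F (\<lambda>x. c * \<phi> x) = c * F \<phi>) \<and>
      (\<exists>C N. \<forall>\<phi>\<in>test_functions. \<forall>B.
          (\<forall>j\<le>N. \<forall>x. cmod (vderiv j \<phi> x) \<le> B) \<longrightarrow> cmod (F \<phi>) \<le> C * B) \<and>
      (\<forall>\<phi>. \<phi> \<notin> test_functions \<longrightarrow> F \<phi> = 0)}"
  morphisms pairing Abs_per_dist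
  by (rule exI[of _ "\<lambda>_. 0"]) (auto intro!: exI[of _ 0])

setup_lifting type_definition_per_dist

instantiation per_dist :: real_vector
begin

lift_definition zero_per_dist :: per_dist is "\<lambda>_. 0"
  by (auto intro!: exI[of _ 0])

lift_definition plus_per_dist :: "per_dist \<Rightarrow> per_dist \<Rightarrow> per_dist" is "\<lambda>F G \<phi>. F \<phi> + G \<phi>"
proof (safe, goal_cases)
  case (3 F G C1 N1 C2 N2)
  have "cmod (F \<phi> + G \<phi>) \<le> (C1 + C2) * B"
    if "\<phi> \<in> test_functions" "\<forall>j\<le>max N1 N2. \<forall>x. cmod (vderiv j \<phi> x) \<le> B" for \<phi> B
  proof -
    have "cmod (F \<phi>) \<le> C1 * B" "cmod (G \<phi>) \<le> C2 * B"
      using 3 that by auto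
    then show ?thesis
      using norm_triangle_ineq[of "F \<phi>" "G \<phi>"] by (simp add: distrib_right)
  qed
  then show ?case by blast
qed (auto simp: algebra_simps)

lift_definition uminus_per_dist :: "per_dist \<Rightarrow> per_dist" is "\<lambda>F \<phi>. - F \<phi>"
  by auto

lift_definition scaleR_per_dist :: "real \<Rightarrow> per_dist \<Rightarrow> per_dist" is "\<lambda>r F \<phi>. r *\<^sub>R F \<phi>"
proof (safe, goal_cases)
  case (3 r F C N)
  have "cmod (r *\<^sub>R F \<phi>) \<le> (\<bar>r\<bar> * C) * B"
    if "\<phi> \<in> test_functions" "\<forall>j\<le>N. \<forall>x. cmod (vderiv j \<phi> x) \<le> B" for \<phi> B
    using 3 that by (auto simp: mult.assoc intro!: mult_left_mono)
  then show ?case by blast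
qed (auto simp: algebra_simps scaleR_conv_of_real)

definition minus_per_dist :: "per_dist \<Rightarrow> per_dist \<Rightarrow> per_dist" where
  "minus_per_dist u v = u + - v"

instance
  by standard (transfer; auto simp: minus_per_dist_def algebra_simps fun_eq_iff)+

end

definition real_valued :: "per_dist \<Rightarrow> bool" where
  "real_valued u \<longleftrightarrow>
     (\<forall>\<phi>\<in>test_functions. (\<forall>x. \<phi> x \<in> \<real>) \<longrightarrow> pairing u \<phi> \<in> \<real>)"

definition fourier_coeff :: "per_dist \<Rightarrow> int \<Rightarrow> complex" where
  "fourier_coeff u k =
     complex_of_real (1 / (2 * pi)) * pairing u (\<lambda>x. exp (- \<i> * of_int k * of_real x))"

text \<open>Trigonometric polynomials are dense in the test functions, so a distribution is determined
  by its Fourier coefficients. This makes the operator below single-valued and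
  \<open>sobolev_metric\<close> a metric. The multiplier exists for symbols of polynomial growth.\<close>

definition fourier_multiplier :: "(int \<Rightarrow> complex) \<Rightarrow> per_dist \<Rightarrow> per_dist" where
  "fourier_multiplier m v = (THE w. \<forall>n. fourier_coeff w n = m n * fourier_coeff v n)"

section \<open>The periodic Sobolev spaces\<close>

definition sobolev_norm :: "real \<Rightarrow> per_dist \<Rightarrow> real" where
  "sobolev_norm s u =
     sqrt (2 * pi *
       (\<Sum>\<^sub>\<infinity>k::int. (1 + (real_of_int \<bar>k\<bar>)\<^sup>2) powr s * (cmod (fourier_coeff u k))\<^sup>2))"

text \<open>The space of real-valued elements, because solutions (hence also initial data) are real.\<close>

definition sobolev_space :: "real \<Rightarrow> per_dist set" where
  "sobolev_space s =
     {u. real_valued u \<and>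
         (\<lambda>k::int. (1 + (real_of_int \<bar>k\<bar>)\<^sup>2) powr s * (cmod (fourier_coeff u k))\<^sup>2)
           summable_on UNIV}"

definition sobolev_metric :: "real \<Rightarrow> per_dist metric" where
  "sobolev_metric s = metric (sobolev_space s, \<lambda>u v. sobolev_norm s (u - v))"

text \<open>\<open>C([-T,T]; H\<^sup>s)\<close> with the supremum metric. In \<open>cfunspace\<close> the functions are
  \<open>extensional\<close> on \<open>{-T..T}\<close>, so equality there means equality on \<open>{-T..T}\<close>.\<close>

definition sobolev_curves :: "real \<Rightarrow> real \<Rightarrow> (real \<Rightarrow> per_dist) metric" where
  "sobolev_curves s T = cfunspace (top_of_set {-T..T}) (sobolev_metric s)"

section \<open>The initial value problem\<close>

text \<open>A function \<open>f\<close> on the period \<open>[-\<pi>,\<pi>]\<close> is identified with the distribution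
  \<open>\<phi> \<mapsto> \<integral> f \<phi>\<close>.\<close>

definition represents :: "(real \<Rightarrow> complex) \<Rightarrow> per_dist \<Rightarrow> bool" where
  "represents f u \<longleftrightarrow>
     set_integrable lborel {-pi..pi} f \<and>
     (\<forall>\<phi>\<in>test_functions. pairing u \<phi> = (LINT x:{-pi..pi}|lborel. f x * \<phi> x))"

text \<open>The pointwise square of a distribution given by a square integrable function. Elements of
  \<open>H\<^sup>s\<close> with \<open>s \<ge> 0\<close> are of this kind.\<close>

definition dist_square :: "per_dist \<Rightarrow> per_dist" where
  "dist_square u = (THE w. \<exists>f. represents f u \<and> represents (\<lambda>x. (f x)\<^sup>2) w)"

text \<open>The oriented integral \<open>\<integral>\<^sub>a\<^sup>b F(\<tau>) d\<tau>\<close> of a distribution-valued function, tested against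
  test functions. For \<open>F\<close> continuous into \<open>H\<^sup>s\<close> it is the Riemann (or Bochner) integral
  in \<open>H\<^sup>s\<close>.\<close>

definition dist_integral :: "real \<Rightarrow> real \<Rightarrow> (real \<Rightarrow> per_dist) \<Rightarrow> per_dist" where
  "dist_integral a b F =
     (THE w. \<forall>\<phi>\<in>test_functions.
        pairing w \<phi> = (LBINT \<tau>=ereal a..ereal b. pairing (F \<tau>) \<phi>))"

text \<open>Applying \<open>(1 + \<H>\<partial>\<^sub>x)\<^sup>-\<^sup>1\<close> to \<open>u\<^sub>t + u\<^sub>x + u u\<^sub>x + \<H>u\<^sub>x\<^sub>t = 0\<close> gives
  \<open>u\<^sub>t = K (u + u\<^sup>2/2)\<close> with \<open>K = -(1 + \<H>\<partial>\<^sub>x)\<^sup>-\<^sup>1\<partial>\<^sub>x\<close>.\<close>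

definition K_op :: "per_dist \<Rightarrow> per_dist" where
  "K_op = fourier_multiplier (\<lambda>n. - \<i> * of_int n / (1 + of_int \<bar>n\<bar>))"

definition is_solution :: "real \<Rightarrow> per_dist \<Rightarrow> (real \<Rightarrow> per_dist) \<Rightarrow> bool" where
  "is_solution T u\<^sub>0 u \<longleftrightarrow>
     (\<forall>t\<in>{-T..T}.
        u t = u\<^sub>0 + dist_integral 0 t (\<lambda>\<tau>. K_op (u \<tau> + (1 / 2) *\<^sub>R dist_square (u \<tau>))))"

end

(*
  Applying (1 + H d/dx)^(-1) turns the equation into the ordinary differential equation
  u' = N(u) = K(u + u^2/2) in H^s: K has a Fourier symbol bounded by 1, and H^s is an algebra for
  s > 1/2, so N is locally Lipschitz. Banach's fixed point theorem in a ball of C([-T,T]; H^s) yields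
  solutions for all data of norm at most |u_0| + 1 on a common interval, and the weighted
  supremum norm sup exp(-l|t|) |u(t) - v(t)| yields at once uniqueness among all solutions and
  Lipschitz dependence on the data. Everything is done on Fourier coefficients, with finite
  partial sums of the square sums. The coefficients determine a distribution because the
  trigonometric polynomials are dense in the test functions (Stone-Weierstrass on the circle).
*)
theory Submission
  imports Defs
begin

section \<open>Trigonometric polynomials\<close>

text \<open>The multiplier, the pointwise square and the time integral are definite descriptions, so
  each needs existence and uniqueness before anything can be computed with it. Since a distribution
  may depend on derivatives of the test function, the multiplier requires trigonometric polynomials
  to be dense in finitely many derivatives at once, not merely uniformly. The square raises a
  different question: two integrable functions that represent the same distribution must agree
  almost everywhere, because it is their pointwise squares that are compared. This is shown by
  passing from orthogonality to trigonometric polynomials to vanishing integrals over all Borel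
  sets. Existence of the multiplier and of the square comes from absolutely convergent Fourier
  series, which s > 1/2 provides: an element of H^s is a continuous function. Existence of the time
  integral comes from a bound on the pairings that is uniform in time; its H^s norm is then
  estimated by duality with its own coefficients.\<close>

inductive_set trigpoly :: "(real \<Rightarrow> complex) set" where
  monomial: "(\<lambda>x. c * cis (of_int k * x)) \<in> trigpoly"
| add: "p \<in> trigpoly \<Longrightarrow> q \<in> trigpoly \<Longrightarrow> (\<lambda>x. p x + q x) \<in> trigpoly"

lemma trigpoly_const: "(\<lambda>x. c) \<in> trigpoly"
  using trigpoly.monomial[of c 0] by simp

lemma trigpoly_mult:
  assumes "p \<in> trigpoly" "q \<in> trigpoly"
  shows "(\<lambda>x. p x * q x) \<in> trigpoly"
  using assms(1)
proof induction
  case (monomial c k)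
  show ?case using assms(2)
  proof induction
    case (monomial d l)
    have "(\<lambda>x. c * cis (of_int k * x) * (d * cis (of_int l * x))) = (\<lambda>x. (c * d) * cis (of_int (k + l) * x))"
      by (simp add: cis_mult[symmetric] distrib_right distrib_left mult_ac)
    then show ?case by (simp only: trigpoly.monomial)
  next
    case (add p q)
    then show ?case by (simp add: distrib_left trigpoly.add)
  qed
next
  case (add p q)
  then show ?case by (simp add: distrib_right trigpoly.add)
qed

lemma trigpoly_cos: "(\<lambda>x. complex_of_real (cos (of_int k * x))) \<in> trigpoly"
proof -
  have "(\<lambda>x. 1 / 2 * cis (of_int k * x) + 1 / 2 * cis (of_int (- k) * x)) \<in> trigpoly"
    by (intro trigpoly.intros)
  moreover have "(\<lambda>x::real. 1 / 2 * cis (of_int k * x) + 1 / 2 * cis (of_int (- k) * x)) =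
      (\<lambda>x. complex_of_real (cos (of_int k * x)))"
    by (auto simp: fun_eq_iff complex_eq_iff)
  ultimately show ?thesis by simp
qed

lemma trigpoly_sin: "(\<lambda>x. complex_of_real (sin (of_int k * x))) \<in> trigpoly"
proof -
  have "(\<lambda>x. - \<i> / 2 * cis (of_int k * x) + \<i> / 2 * cis (of_int (- k) * x)) \<in> trigpoly"
    by (intro trigpoly.intros)
  moreover have "(\<lambda>x::real. - \<i> / 2 * cis (of_int k * x) + \<i> / 2 * cis (of_int (- k) * x)) =
      (\<lambda>x. complex_of_real (sin (of_int k * x)))"
    by (auto simp: fun_eq_iff complex_eq_iff)
  ultimately show ?thesis by simp
qed

text \<open>The bridge from Stone-Weierstrass, whose approximants are polynomials on the plane. On
  the circle a real-linear functional is a combination of cos x and sin x; everything else is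
  closure under sums and products.\<close>

lemma trigpoly_real_polynomial_circle:
  assumes "real_polynomial_function (g :: complex \<Rightarrow> real)"
  shows "(\<lambda>x. complex_of_real (g (cis x))) \<in> trigpoly"
  using assms
proof induction
  case (linear f)
  interpret bounded_linear f by fact
  have "f (cis x) = cos x * f 1 + sin x * f \<i>" for x
  proof -
    have "cis x = cos x *\<^sub>R 1 + sin x *\<^sub>R \<i>" by (simp add: complex_eq_iff)
    then show ?thesis by (simp only: add scaleR) simp
  qed
  moreover have "(\<lambda>x. of_real (cos (of_int 1 * x)) * of_real (f 1) + of_real (sin (of_int 1 * x)) * complex_of_real (f \<i>))
      \<in> trigpoly"
    by (intro trigpoly.add trigpoly_mult trigpoly_const trigpoly_cos trigpoly_sin)
  ultimately show ?case by simp
qed (auto intro: trigpoly_const trigpoly.add trigpoly_mult)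

text \<open>Periodic functions descend to the unit circle. Shifts by a natural number of periods
  come by induction; a negative multiple is handled by exchanging \<open>a\<close> and
  \<open>b\<close>.\<close>

lemma periodic_cis_cong:
  assumes per: "\<And>x. \<phi> (x + 2 * pi) = (\<phi> x :: complex)" and "cis a = cis b"
  shows "\<phi> a = \<phi> b"
proof -
  have nat: "\<phi> (x + 2 * pi * real n) = \<phi> x" for x n
    by (induction n) (simp_all add: distrib_left add.assoc[symmetric] per, metis add.commute add.left_commute per)
  from assms(2) have "sin a = sin b \<and> cos a = cos b" by (simp add: complex_eq_iff)
  then obtain n :: int where n: "a = b + 2 * pi * n" using sin_cos_eq_iff by blast
  show ?thesis
  proof (cases "n \<ge> 0")
    case True
    then show ?thesis using nat[of b "nat n"] n by simp
  next
    case False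
    then show ?thesis using nat[of a "nat (- n)"] n by simp
  qed
qed

text \<open>\<open>Arg\<close> jumps across the negative axis. Near z the angle \<open>Arg w\<close>
  is therefore replaced by \<open>Arg z + Arg (w / z)\<close>: the quotient is close to 1, where
  \<open>Arg\<close> is continuous, and on the circle both angles differ by a multiple of 2 pi,
  which \<phi> does not see.\<close>

lemma continuous_on_circle_periodic:
  assumes cont: "continuous_on UNIV \<phi>" and per: "\<And>x. \<phi> (x + 2 * pi) = (\<phi> x :: complex)"
  shows "continuous_on (sphere 0 1) (\<lambda>z. \<phi> (Arg z))"
proof -
  have "isCont (\<lambda>w. \<phi> (Arg z + Arg (w / z))) z" if "cmod z = 1" for z
  proof -
    have "z \<noteq> 0" using that by auto
    then have "isCont (\<lambda>w. Arg (w / z)) z"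
      by (intro isCont_o2[where f = "\<lambda>w. w / z" and g = Arg] continuous_intros continuous_at_Arg)
        (auto simp: complex_nonpos_Reals_iff)
    moreover have "isCont \<phi> y" for y
      using cont by (simp add: continuous_on_eq_continuous_at)
    ultimately show ?thesis
      by (intro isCont_o2[OF _ \<open>\<And>y. isCont \<phi> y\<close>]) (intro continuous_intros)
  qed
  then have "continuous (at z within sphere 0 1) (\<lambda>w. \<phi> (Arg z + Arg (w / z)))" if "z \<in> sphere 0 1" for z
    using that continuous_at_imp_continuous_at_within by auto
  moreover have "\<phi> (Arg z + Arg (w / z)) = \<phi> (Arg w)" if "z \<in> sphere 0 1" "w \<in> sphere 0 1" for z w
  proof (rule periodic_cis_cong[of \<phi>, OF per])
    have "z \<noteq> 0" "w \<noteq> 0" using that by auto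
    then have "cis (Arg z) = z" "cis (Arg w) = w" "cis (Arg (w / z)) = w / z"
      using that by (auto simp: cis_Arg sgn_div_norm norm_divide)
    then show "cis (Arg z + Arg (w / z)) = cis (Arg w)"
      using \<open>z \<noteq> 0\<close> by (simp add: cis_mult[symmetric])
  qed
  ultimately show ?thesis
    unfolding continuous_on_eq_continuous_within continuous_within
    by (metis (no_types, lifting) Lim_cong_within)
qed

lemma trigpoly_uniformly_dense:
  assumes cont: "continuous_on UNIV \<phi>" and per: "\<And>x. \<phi> (x + 2 * pi) = (\<phi> x :: complex)" and "0 < e"
  obtains p where "p \<in> trigpoly" "\<And>x. cmod (\<phi> x - p x) < e"
proof -
  obtain g where g: "polynomial_function g" "\<And>z. z \<in> sphere 0 1 \<Longrightarrow> cmod (\<phi> (Arg z) - g z) < e"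
    using Stone_Weierstrass_polynomial_function[OF compact_sphere continuous_on_circle_periodic[OF cont per] \<open>0 < e\<close>]
    by blast
  have "(\<lambda>x. complex_of_real ((Re \<circ> g) (cis x)) + \<i> * complex_of_real ((Im \<circ> g) (cis x))) \<in> trigpoly"
    using g(1) bounded_linear_Re bounded_linear_Im unfolding polynomial_function_def
    by (intro trigpoly.add trigpoly_mult trigpoly_const trigpoly_real_polynomial_circle) blast+
  moreover have "complex_of_real ((Re \<circ> g) z) + \<i> * complex_of_real ((Im \<circ> g) z) = g z" for z
    by (simp add: complex_eq_iff)
  ultimately have "(\<lambda>x. g (cis x)) \<in> trigpoly" by simp
  moreover have "cmod (\<phi> x - g (cis x)) < e" for x
  proof -
    have "\<phi> x = \<phi> (Arg (cis x))"
      by (rule periodic_cis_cong[of \<phi>, OF per]) (auto simp: cis_Arg sgn_div_norm)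
    then show ?thesis using g(2)[of "cis x"] by simp
  qed
  ultimately show ?thesis using that by blast
qed

text \<open>The constant \<open>c\<close> collects the terms of frequency 0, the only ones without a
  periodic primitive.\<close>

lemma trigpoly_primitive:
  assumes "p \<in> trigpoly"
  obtains q c where "q \<in> trigpoly" "\<And>x. (q has_vector_derivative (p x - c)) (at x)"
proof -
  have "\<exists>q\<in>trigpoly. \<exists>c. \<forall>x. (q has_vector_derivative (p x - c)) (at x)"
    using assms
  proof induction
    case (monomial c k)
    show ?case
    proof (cases "k = 0")
      case True
      then show ?thesis by (intro bexI[OF _ trigpoly_const[of 0]] exI[of _ c]) auto
    next
      case False
      have "((\<lambda>x. c / (\<i> * k) * cis (of_int k * x)) has_vector_derivative c * cis (of_int k * x) - 0) (at x)" for x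
        using False unfolding has_vector_derivative_def
        by (auto intro!: derivative_eq_intros simp: fun_eq_iff scaleR_conv_of_real field_simps)
      then show ?thesis using trigpoly.monomial by blast
    qed
  next
    case (add p q)
    then obtain p' c q' d where *: "p' \<in> trigpoly" "q' \<in> trigpoly"
      "\<And>x. (p' has_vector_derivative (p x - c)) (at x)" "\<And>x. (q' has_vector_derivative (q x - d)) (at x)"
      by blast
    have "((\<lambda>x. p' x + q' x) has_vector_derivative (p x + q x - (c + d))) (at x)" for x
      using has_vector_derivative_add[OF *(3) *(4), of x] by (simp add: algebra_simps)
    then show ?case using trigpoly.add *(1,2) by blast
  qed
  then show ?thesis using that by blast
qed

section \<open>Test functions and the uniqueness of Fourier coefficients\<close>

lemma vderiv_0 [simp]: "vderiv 0 \<phi> = \<phi>"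
  by (simp add: vderiv_def)

lemma vderiv_Suc: "vderiv (Suc n) \<phi> = (\<lambda>x. vector_derivative (vderiv n \<phi>) (at x))"
  by (simp add: vderiv_def)

lemma vderiv_Suc2: "vderiv (Suc n) \<phi> = vderiv n (\<lambda>x. vector_derivative \<phi> (at x))"
  by (simp add: vderiv_def funpow_Suc_right del: funpow.simps)

lemma test_functions_vderiv:
  assumes "\<phi> \<in> test_functions"
  shows "(vderiv n \<phi> has_vector_derivative vderiv (Suc n) \<phi> x) (at x)"
  using assms by (simp add: test_functions_def vderiv_Suc vector_derivative_works[symmetric])

lemma test_functions_periodic: "\<phi> \<in> test_functions \<Longrightarrow> \<phi> (x + 2 * pi) = \<phi> x"
  by (simp add: test_functions_def)

lemma test_functions_continuous: "\<phi> \<in> test_functions \<Longrightarrow> continuous_on A \<phi>"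
  using test_functions_vderiv[of \<phi> 0]
  by (auto intro!: continuous_at_imp_continuous_on has_vector_derivative_continuous)

text \<open>Supplying all derivatives as one family \<open>D\<close> gives smoothness and the values
  of \<open>vderiv\<close> by a single induction.\<close>

lemma test_functionsI:
  assumes "\<And>x. D 0 (x + 2 * pi) = D 0 x"
    and "\<And>n x. (D n has_vector_derivative D (Suc n) x) (at x)"
  shows "D 0 \<in> test_functions" "vderiv n (D 0) = D n"
proof -
  have *: "vderiv n (D 0) = D n" for n
    by (induction n) (auto simp: vderiv_Suc vector_derivative_at[OF assms(2)])
  show "vderiv n (D 0) = D n" by (rule *)
  show "D 0 \<in> test_functions"
    using assms by (auto simp: test_functions_def * intro: differentiableI_vector)
qed

lemma test_functions_add:
  assumes "\<phi> \<in> test_functions" "\<psi> \<in> test_functions"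
  shows "(\<lambda>x. \<phi> x + \<psi> x) \<in> test_functions" "vderiv n (\<lambda>x. \<phi> x + \<psi> x) = (\<lambda>x. vderiv n \<phi> x + vderiv n \<psi> x)"
  using test_functionsI[of "\<lambda>n x. vderiv n \<phi> x + vderiv n \<psi> x"]
    has_vector_derivative_add[OF test_functions_vderiv[OF assms(1)] test_functions_vderiv[OF assms(2)]]
  by (auto simp: test_functions_periodic assms)

lemma test_functions_cmult:
  assumes "\<phi> \<in> test_functions"
  shows "(\<lambda>x. c * \<phi> x) \<in> test_functions" "vderiv n (\<lambda>x. c * \<phi> x) = (\<lambda>x. c * vderiv n \<phi> x)"
  using test_functionsI[of "\<lambda>n x. c * vderiv n \<phi> x"]
    has_vector_derivative_mult_right[OF test_functions_vderiv[OF assms], of c]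
  by (auto simp: test_functions_periodic assms)

lemma test_functions_deriv:
  assumes "\<phi> \<in> test_functions"
  shows "vderiv 1 \<phi> \<in> test_functions"
proof -
  have "vderiv 1 \<phi> (x + 2 * pi) = vderiv 1 \<phi> x" for x
  proof -
    have "((\<lambda>y. y + 2 * pi) has_vector_derivative 1) (at x)"
      by (auto intro!: derivative_eq_intros)
    from vector_diff_chain_at[OF this test_functions_vderiv[OF assms, of 0]]
    have "(\<phi> has_vector_derivative vderiv 1 \<phi> (x + 2 * pi)) (at x)"
      using assms by (simp add: o_def test_functions_periodic)
    then show ?thesis
      using vector_derivative_unique_at test_functions_vderiv[OF assms, of 0 x] by fastforce
  qed
  then show ?thesis
    using test_functionsI[of "\<lambda>n. vderiv (Suc n) \<phi>"] test_functions_vderiv[OF assms] by simp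
qed

lemma test_functions_monomial:
  "(\<lambda>x. c * cis (of_int k * x)) \<in> test_functions"
proof -
  let ?D = "\<lambda>n x. c * (\<i> * of_int k) ^ n * cis (of_int k * x)"
  have "?D 0 \<in> test_functions"
  proof (rule test_functionsI)
    fix x show "?D 0 (x + 2 * pi) = ?D 0 x"
      using cis_multiple_2pi[of "real_of_int k"]
      by (simp add: cis_mult[symmetric] distrib_left mult.commute mult.left_commute)
  next
    fix n x show "(?D n has_vector_derivative ?D (Suc n) x) (at x)"
      unfolding has_vector_derivative_def
      by (auto intro!: derivative_eq_intros simp: fun_eq_iff scaleR_conv_of_real field_simps)
  qed
  then show ?thesis by simp
qed

lemma trigpoly_test_functions: "p \<in> trigpoly \<Longrightarrow> p \<in> test_functions"
  by (induction rule: trigpoly.induct) (auto intro: test_functions_monomial test_functions_add)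

lemma test_functions_diff:
  assumes "\<phi> \<in> test_functions" "\<psi> \<in> test_functions"
  shows "(\<lambda>x. \<phi> x - \<psi> x) \<in> test_functions"
  using test_functions_add[OF assms(1) test_functions_cmult(1)[OF assms(2), of "-1"]] by simp

lemma vector_derivative_bound:
  fixes f :: "real \<Rightarrow> 'a :: real_normed_vector"
  assumes "\<And>x. (f has_vector_derivative f' x) (at x)" "\<And>x. norm (f' x) \<le> B"
  shows "norm (f x - f y) \<le> B * \<bar>x - y\<bar>"
proof -
  have "onorm (\<lambda>h. h *\<^sub>R f' z) \<le> B" for z
    by (rule onorm_le) (simp add: assms(2) mult.commute[of B] mult_left_mono)
  then show ?thesis
    using differentiable_bound[of UNIV f "\<lambda>x h. h *\<^sub>R f' x" B] assms(1)
    by (simp add: has_vector_derivative_def)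
qed

text \<open>The induction on the order of differentiation integrates an approximation of \<open>\<phi>'\<close>; its mean is
  small because \<open>\<phi>'\<close> has mean zero.\<close>

lemma trigpoly_dense_test_functions:
  assumes "\<phi> \<in> test_functions" "0 < e"
  shows "\<exists>p\<in>trigpoly. \<forall>j\<le>N. \<forall>x. cmod (vderiv j (\<lambda>x. \<phi> x - p x) x) \<le> e"
  using assms
proof (induction N arbitrary: \<phi> e)
  case 0
  then obtain p where "p \<in> trigpoly" "\<And>x. cmod (\<phi> x - p x) < e"
    using trigpoly_uniformly_dense[of \<phi> e] test_functions_continuous test_functions_periodic by blast
  then show ?case by (intro bexI[of _ p]) (auto intro: less_imp_le)
next
  case (Suc N)
  \<comment> \<open>The derivatives of the error will be bounded by 2 d, and the error itself by 2 d
    times the period 2 pi; this \<open>d\<close> keeps both below \<open>e\<close>.\<close>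
  define d where "d = e / (4 * pi + 2)"
  have d: "d > 0" "2 * d \<le> e" "2 * d * (2 * pi) \<le> e"
    using Suc.prems pi_gt_zero by (auto simp: d_def divide_simps add_pos_pos mult_pos_pos)
  obtain p where p: "p \<in> trigpoly" "\<And>j x. j \<le> N \<Longrightarrow> cmod (vderiv j (\<lambda>x. vderiv 1 \<phi> x - p x) x) \<le> d"
    using Suc.IH[OF test_functions_deriv[OF Suc.prems(1)] d(1)] by blast
  obtain q c where q: "q \<in> trigpoly" "\<And>x. (q has_vector_derivative (p x - c)) (at x)"
    using trigpoly_primitive[OF p(1)] by blast
  have phi': "(\<phi> has_vector_derivative vderiv 1 \<phi> x) (at x)" for x
    using test_functions_vderiv[OF Suc.prems(1), of 0 x] by simp
  note q_test = trigpoly_test_functions[OF q(1)] and p_test = trigpoly_test_functions[OF p(1)]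
  have per: "\<phi> (2 * pi) = \<phi> 0" "q (2 * pi) = q 0"
    using test_functions_periodic[of _ 0] Suc.prems(1) q_test by fastforce+
  \<comment> \<open>\<open>?k\<close> has derivative \<phi>' - p. Since \<phi> and \<open>q\<close>
    are periodic, its increment over one period is - 2 pi c, so the bound on the derivative is a
    bound on \<open>c\<close>.\<close>
  have c: "cmod c \<le> d"
  proof -
    let ?k = "\<lambda>x. \<phi> x - q x - x *\<^sub>R c"
    have "(?k has_vector_derivative vderiv 1 \<phi> x - p x) (at x)" for x
      using phi'[of x] q(2)[of x] by (auto intro!: derivative_eq_intros)
    moreover have "cmod (vderiv 1 \<phi> x - p x) \<le> d" for x
      using p(2)[of 0] by simp
    ultimately have "cmod (?k (2 * pi) - ?k 0) \<le> d * \<bar>2 * pi - 0\<bar>"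
      by (rule vector_derivative_bound)
    then show ?thesis using d per by (simp add: norm_mult)
  qed
  \<comment> \<open>The added constant makes the error \<open>h\<close> vanish at 0, so that
    \<open>h\<close> is controlled by its derivative.\<close>
  define q0 where "q0 = (\<lambda>x. q x + (\<phi> 0 - q 0))"
  have q0: "q0 \<in> trigpoly" unfolding q0_def by (intro trigpoly.add q trigpoly_const)
  define h where "h = (\<lambda>x. \<phi> x - q0 x)"
  have h: "h \<in> test_functions"
    unfolding h_def by (intro test_functions_diff Suc.prems trigpoly_test_functions q0)
  have h': "(h has_vector_derivative (vderiv 1 \<phi> x - p x) + c) (at x)" for x
    unfolding h_def q0_def using phi'[of x] q(2)[of x] by (auto intro!: derivative_eq_intros)
  have const: "cmod (vderiv j (\<lambda>x. c) x) \<le> d" for j x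
  proof -
    have "vderiv j (\<lambda>x. c) = (\<lambda>x. if j = 0 then c else 0)"
      using test_functionsI(2)[of "\<lambda>j x. if j = 0 then c else 0" j] by auto
    then show ?thesis using c d by auto
  qed
  have Suc_j: "cmod (vderiv (Suc j) h x) \<le> 2 * d" if "j \<le> N" for j x
  proof -
    have "vderiv (Suc j) h = vderiv j (\<lambda>x. (vderiv 1 \<phi> x - p x) + c)"
      by (simp add: vderiv_Suc2 vector_derivative_at[OF h'])
    also have "\<dots> = (\<lambda>x. vderiv j (\<lambda>x. vderiv 1 \<phi> x - p x) x + vderiv j (\<lambda>x. c) x)"
      by (intro test_functions_add test_functions_diff test_functions_deriv Suc.prems p_test
          trigpoly_test_functions trigpoly_const)
    finally show ?thesis
      using norm_triangle_mono[OF p(2)[OF that, of x] const[of j x]] by simp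
  qed
  \<comment> \<open>By periodicity x is replaced by a representative y in [0, 2 pi), at distance at
    most one period from the zero of \<open>h\<close>.\<close>
  have zero: "cmod (h x) \<le> e" for x
  proof -
    define y where "y = Arg2pi (cis x)"
    have y: "0 \<le> y" "y < 2 * pi" "cis y = cis x"
      using Arg2pi[of "cis x"] by (auto simp: y_def is_Arg_def cis_conv_exp)
    have "cmod (h y - h 0) \<le> (2 * d) * \<bar>y - 0\<bar>"
      using test_functions_vderiv[OF h, of 0] Suc_j[of 0]
      by (intro vector_derivative_bound[where f' = "vderiv 1 h"]) simp_all
    also have "\<dots> \<le> 2 * d * (2 * pi)" using y d by (intro mult_left_mono) auto
    also have "\<dots> \<le> e" by (rule d)
    finally have "cmod (h y - h 0) \<le> e" .
    moreover have "h 0 = 0" by (simp add: h_def q0_def)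
    moreover have "h y = h x"
      using periodic_cis_cong[of h, OF test_functions_periodic[OF h] y(3)] .
    ultimately show ?thesis by simp
  qed
  have "cmod (vderiv j h x) \<le> e" if "j \<le> Suc N" for j x
    using that zero Suc_j[of "j - 1" x] d by (cases j) (auto intro: order_trans)
  then show ?case using q0 unfolding h_def by blast
qed

section \<open>Distributions are determined by their Fourier coefficients\<close>

lemma pairing_add: "\<phi> \<in> test_functions \<Longrightarrow> \<psi> \<in> test_functions \<Longrightarrow> pairing u (\<lambda>x. \<phi> x + \<psi> x) = pairing u \<phi> + pairing u \<psi>"
  using pairing[of u] by simp

lemma pairing_cmult: "\<phi> \<in> test_functions \<Longrightarrow> pairing u (\<lambda>x. c * \<phi> x) = c * pairing u \<phi>"
  using pairing[of u] by simp

lemma pairing_outside: "\<phi> \<notin> test_functions \<Longrightarrow> pairing u \<phi> = 0"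
  using pairing[of u] by simp

lemma pairing_diff: "\<phi> \<in> test_functions \<Longrightarrow> \<psi> \<in> test_functions \<Longrightarrow> pairing u (\<lambda>x. \<phi> x - \<psi> x) = pairing u \<phi> - pairing u \<psi>"
  using pairing_add[of \<phi> "\<lambda>x. -1 * \<psi> x" u] test_functions_cmult(1)[of \<psi> "-1"] pairing_cmult[of \<psi> u "-1"] by simp

lemma pairing_bounded:
  "\<exists>C N. \<forall>\<phi>\<in>test_functions. \<forall>B. (\<forall>j\<le>N. \<forall>x. cmod (vderiv j \<phi> x) \<le> B) \<longrightarrow> cmod (pairing u \<phi>) \<le> C * B"
  using pairing[of u] by simp

lemma fourier_coeff_pairing: "pairing u (\<lambda>x. cis (of_int (- k) * x)) = of_real (2 * pi) * fourier_coeff u k"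
  by (simp add: fourier_coeff_def cis_conv_exp mult.assoc mult.left_commute)

text \<open>Each functional is bounded by finitely many derivatives. A trigonometric polynomial
  close to \<phi> in all derivatives up to \<open>max N M\<close> serves both functionals, and on it
  they agree.\<close>

lemma per_dist_eqI:
  assumes "\<And>k. fourier_coeff u k = fourier_coeff v k"
  shows "u = v"
proof -
  have trig: "pairing u p = pairing v p" if "p \<in> trigpoly" for p
    using that
  proof induction
    case (monomial c k)
    show ?case
      using assms[of "- k"] fourier_coeff_pairing[of u "- k"] fourier_coeff_pairing[of v "- k"]
        pairing_cmult[OF test_functions_monomial[of 1 k], of _ c] by simp
  next
    case (add p q)
    then show ?case using pairing_add[OF trigpoly_test_functions trigpoly_test_functions] by simp
  qed
  have "pairing u \<phi> = pairing v \<phi>" if \<phi>: "\<phi> \<in> test_functions" for \<phi>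
  proof -
    from pairing_bounded[of u] obtain C N where CN: "\<forall>\<phi>\<in>test_functions. \<forall>B. (\<forall>j\<le>N. \<forall>x. cmod (vderiv j \<phi> x) \<le> B) \<longrightarrow> cmod (pairing u \<phi>) \<le> C * B"
      by (elim exE)
    from pairing_bounded[of v] obtain D M where DM: "\<forall>\<phi>\<in>test_functions. \<forall>B. (\<forall>j\<le>M. \<forall>x. cmod (vderiv j \<phi> x) \<le> B) \<longrightarrow> cmod (pairing v \<phi>) \<le> D * B"
      by (elim exE)
    have "cmod (pairing u \<phi> - pairing v \<phi>) \<le> (C + D) * e" if e: "e > 0" for e
    proof -
      obtain p where p: "p \<in> trigpoly" "\<And>j x. j \<le> max N M \<Longrightarrow> cmod (vderiv j (\<lambda>x. \<phi> x - p x) x) \<le> e"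
        using trigpoly_dense_test_functions[OF \<phi> e] by blast
      note p' = trigpoly_test_functions[OF p(1)]
      have "cmod (pairing u (\<lambda>x. \<phi> x - p x)) \<le> C * e" "cmod (pairing v (\<lambda>x. \<phi> x - p x)) \<le> D * e"
        by (intro CN[rule_format] DM[rule_format] test_functions_diff \<phi> p' p(2); simp)+
      then have "cmod (pairing u (\<lambda>x. \<phi> x - p x) - pairing v (\<lambda>x. \<phi> x - p x)) \<le> C * e + D * e"
        by (smt (verit) norm_triangle_ineq4)
      then show ?thesis
        using trig[OF p(1)] pairing_diff[OF \<phi> p'] by (simp add: distrib_right)
    qed
    note le = this
    \<comment> \<open>The sign of \<open>C + D\<close> is unknown; dividing the accuracy by its
      absolute value plus 1 makes the preceding bound at most \<open>e\<close>.\<close>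
    have "cmod (pairing u \<phi> - pairing v \<phi>) \<le> 0 + e" if "e > 0" for e
    proof -
      have "cmod (pairing u \<phi> - pairing v \<phi>) \<le> (C + D) * (e / (\<bar>C + D\<bar> + 1))"
        using that by (intro le) auto
      also have "\<dots> \<le> e"
        using that abs_ge_self[of "C + D"] by (simp add: divide_simps mult.commute[of e] mult_right_mono)
      finally show ?thesis by simp
    qed
    then have "cmod (pairing u \<phi> - pairing v \<phi>) \<le> 0" by (rule field_le_epsilon)
    then show ?thesis by simp
  qed
  then have "pairing u = pairing v"
    by (intro ext) (metis pairing_outside)
  then show ?thesis by (simp add: pairing_inject)
qed

section \<open>Integrable functions with vanishing Fourier coefficients\<close>

context
  fixes H :: "real \<Rightarrow> complex"
  assumes integrable: "integrable lborel H"
    and supp: "\<And>x. x \<notin> {-pi..pi} \<Longrightarrow> H x = 0"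
    and orthogonal: "\<And>p. p \<in> trigpoly \<Longrightarrow> (LINT x|lborel. H x * p x) = 0"
begin

lemma integrable_mult_bounded:
  assumes "f \<in> borel_measurable borel" "\<And>x. cmod (f x) \<le> B"
  shows "integrable lborel (\<lambda>x. H x * f x)"
proof (rule Bochner_Integration.integrable_bound)
  show "integrable lborel (\<lambda>x. B * norm (H x))" using integrable by simp
  show "(\<lambda>x. H x * f x) \<in> borel_measurable lborel"
    using integrable assms(1) by (intro borel_measurable_times) auto
  show "AE x in lborel. norm (H x * f x) \<le> norm (B * norm (H x))"
    using assms(2) by (auto simp: norm_mult mult.commute[of B] intro!: AE_I2 mult_left_mono order_trans[OF _ abs_ge_self])
qed

text \<open>Replacing a continuous periodic function by a trigonometric polynomial at uniform
  distance \<open>d\<close> costs at most \<open>d\<close> times the L1 norm of \<open>H\<close>.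
  Working with functions of \<open>cis x\<close> makes periodicity automatic.\<close>

lemma orthogonal_continuous:
  assumes "continuous_on UNIV F"
  shows "(LINT x|lborel. H x * F (cis x)) = 0"
proof -
  have cont: "continuous_on UNIV (\<lambda>x. F (cis x))"
    by (intro continuous_on_compose2[OF assms] continuous_intros) auto
  have per: "F (cis (x + 2 * pi)) = F (cis x)" for x
    by (simp add: cis_mult[symmetric])
  have "compact (F ` sphere 0 1)"
    by (intro compact_continuous_image continuous_on_subset[OF assms]) auto
  from compact_imp_bounded[OF this] obtain B where B: "\<And>z. z \<in> sphere 0 1 \<Longrightarrow> cmod (F z) \<le> B"
    by (metis bounded_iff imageI)
  have int_F: "integrable lborel (\<lambda>x. H x * F (cis x))"
    by (rule integrable_mult_bounded[where B = B]) (auto intro: borel_measurable_continuous_onI cont B)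
  have "cmod (LINT x|lborel. H x * F (cis x)) \<le> 0 + e" if "e > 0" for e
  proof -
    define I where "I = (LINT x|lborel. norm (H x))"
    have I: "0 \<le> I" by (simp add: I_def)
    define d where "d = e / (I + 1)"
    have d: "d > 0" "d * I \<le> e" using that I by (auto simp: d_def divide_simps)
    obtain p where p: "p \<in> trigpoly" "\<And>x. cmod (F (cis x) - p x) < d"
      using trigpoly_uniformly_dense[OF cont per d(1)] by blast
    have cont_p: "continuous_on UNIV p"
      by (intro test_functions_continuous trigpoly_test_functions p)
    have int_diff: "integrable lborel (\<lambda>x. H x * (F (cis x) - p x))"
      using p(2) by (intro integrable_mult_bounded[where B = d] borel_measurable_continuous_onI
          continuous_on_diff cont cont_p) (auto intro: less_imp_le)
    have "integrable lborel (\<lambda>x. H x * F (cis x) - H x * (F (cis x) - p x))"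
      by (intro Bochner_Integration.integrable_diff int_F int_diff)
    then have int_p: "integrable lborel (\<lambda>x. H x * p x)"
      by (simp add: algebra_simps)
    have "(LINT x|lborel. H x * F (cis x)) = (LINT x|lborel. H x * (F (cis x) - p x)) + (LINT x|lborel. H x * p x)"
      by (subst Bochner_Integration.integral_add[OF int_diff int_p, symmetric]) (simp add: algebra_simps)
    then have "cmod (LINT x|lborel. H x * F (cis x)) = cmod (LINT x|lborel. H x * (F (cis x) - p x))"
      by (simp add: orthogonal[OF p(1)])
    also have "\<dots> \<le> (LINT x|lborel. norm (H x * (F (cis x) - p x)))" by simp
    also have "\<dots> \<le> (LINT x|lborel. d * norm (H x))"
    proof (intro integral_mono)
      show "integrable lborel (\<lambda>x. norm (H x * (F (cis x) - p x)))" using int_diff by (rule integrable_norm)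
      show "integrable lborel (\<lambda>x. d * norm (H x))" using integrable by simp
      show "norm (H x * (F (cis x) - p x)) \<le> d * norm (H x)" for x
        using less_imp_le[OF p(2)[of x]] by (simp add: norm_mult mult.commute[of d] mult_left_mono)
    qed
    also have "\<dots> \<le> e" using d by (simp add: I_def)
    finally show ?thesis by simp
  qed
  then have "cmod (LINT x|lborel. H x * F (cis x)) \<le> 0" by (rule field_le_epsilon)
  then show ?thesis by simp
qed

text \<open>The indicator of an open set is the limit of the continuous functions min (1, n dist (z,
  - W)), and \<open>norm (H x)\<close> dominates. The complement has to be nonempty because
  \<open>infdist\<close> to the empty set is 0 by convention.\<close>

lemma orthogonal_open_circle:
  assumes "open W" "W \<noteq> UNIV"
  shows "(LINT x|lborel. H x * indicator W (cis x)) = 0"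
proof -
  let ?F = "\<lambda>n z. complex_of_real (min 1 (real n * infdist z (- W)))"
  have pos: "0 \<le> real n * infdist z (- W)" for n z by (simp add: infdist_nonneg)
  have cont: "continuous_on A (?F n)" for n A
    by (intro continuous_intros)
  have lim: "(\<lambda>n. ?F n z) \<longlonglongrightarrow> indicator W z" for z
  proof (cases "z \<in> W")
    case True
    then have "infdist z (- W) > 0"
      using assms by (subst infdist_pos_not_in_closed) auto
    then have "filterlim (\<lambda>n. real n * infdist z (- W)) at_top sequentially"
      by (intro filterlim_at_top_mult_tendsto_pos[OF tendsto_const _ filterlim_real_sequentially])
    then have "eventually (\<lambda>n. real n * infdist z (- W) \<ge> 1) sequentially"
      by (auto simp: filterlim_at_top)
    then have "eventually (\<lambda>n. ?F n z = 1) sequentially"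
      by (rule eventually_mono) auto
    then show ?thesis using True by (simp add: tendsto_eventually)
  next
    case False
    then show ?thesis by simp
  qed
  have "(\<lambda>n. LINT x|lborel. H x * ?F n (cis x)) \<longlonglongrightarrow> (LINT x|lborel. H x * indicator W (cis x))"
  proof (rule integral_dominated_convergence[where w = "\<lambda>x. norm (H x)"])
    have [measurable]: "H \<in> borel_measurable borel" using integrable by auto
    have [measurable]: "cis \<in> borel_measurable borel"
      by (intro borel_measurable_continuous_onI continuous_intros)
    have [measurable]: "W \<in> sets borel" using assms by simp
    show "(\<lambda>x. H x * indicator W (cis x)) \<in> borel_measurable lborel" by measurable
    have "(\<lambda>x. ?F n (cis x)) \<in> borel_measurable borel" for n
      by (intro borel_measurable_continuous_onI continuous_on_compose2[OF cont] continuous_intros) auto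
    then show "(\<lambda>x. H x * ?F n (cis x)) \<in> borel_measurable lborel" for n
      by simp
    show "AE x in lborel. norm (H x * ?F n (cis x)) \<le> norm (H x)" for n
      using pos by (auto simp: norm_mult intro!: mult_left_le)
    show "AE x in lborel. (\<lambda>n. H x * ?F n (cis x)) \<longlonglongrightarrow> H x * indicator W (cis x)"
      by (intro AE_I2 tendsto_intros lim)
  qed (use integrable in auto)
  moreover have "(LINT x|lborel. H x * ?F n (cis x)) = 0" for n
    by (rule orthogonal_continuous[OF cont])
  ultimately show ?thesis by (simp add: LIMSEQ_const_iff)
qed

text \<open>An open set of angles is pulled back to the plane along \<open>Arg\<close>, with the
  negative axis removed so that the preimage is open. This loses only the angles pi and - pi, a null
  set. Since 0 is removed too, the preimage is a proper subset.\<close>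

lemma orthogonal_open:
  assumes "open A"
  shows "(LINT x:A|lborel. H x) = 0"
proof -
  define W where "W = Arg -` A \<inter> (- \<real>\<^sub>\<le>\<^sub>0)"
  have "open W"
    unfolding W_def using assms
    by (intro continuous_open_preimage[of "- \<real>\<^sub>\<le>\<^sub>0" Arg A, unfolded Int_commute[of "- \<real>\<^sub>\<le>\<^sub>0"]])
       (auto intro!: continuous_at_imp_continuous_on continuous_at_Arg)
  moreover have "0 \<notin> W" by (simp add: W_def)
  ultimately have "0 = (LINT x|lborel. H x * indicator W (cis x))"
    by (metis orthogonal_open_circle UNIV_I)
  also have "\<dots> = (LINT x:A|lborel. H x)"
    unfolding set_lebesgue_integral_def
  proof (rule Bochner_Integration.integral_cong_AE)
    have [measurable]: "H \<in> borel_measurable borel" using integrable by auto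
    have [measurable]: "cis \<in> borel_measurable borel"
      by (intro borel_measurable_continuous_onI continuous_intros)
    have [measurable]: "W \<in> sets borel" "A \<in> sets borel" using assms \<open>open W\<close> by auto
    show "(\<lambda>x. H x * indicator W (cis x)) \<in> borel_measurable lborel"
      "(\<lambda>x. indicat_real A x *\<^sub>R H x) \<in> borel_measurable lborel"
      by measurable
    have "H x * indicator W (cis x) = indicat_real A x *\<^sub>R H x" if "x \<noteq> pi" "x \<noteq> - pi" for x
    proof (cases "x \<in> {-pi..pi}")
      case True
      then have x: "-pi < x" "x < pi" using that by auto
      then have "Arg (cis x) = x" by (simp add: Arg_cis)
      moreover have "cis x \<notin> \<real>\<^sub>\<le>\<^sub>0"
      proof
        assume "cis x \<in> \<real>\<^sub>\<le>\<^sub>0"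
        then have "Re (cis x) \<le> 0" "Im (cis x) = 0" by (auto simp: complex_nonpos_Reals_iff)
        then have "cis x = - 1" using norm_cis[of x] by (auto simp: complex_eq_iff cmod_def)
        then show False using \<open>Arg (cis x) = x\<close> x Arg_eq_pi[of "-1"] by simp
      qed
      ultimately have "cis x \<in> W \<longleftrightarrow> x \<in> A" by (simp add: W_def)
      then show ?thesis by (simp add: indicator_def)
    qed (simp add: supp)
    then show "AE x in lborel. H x * indicator W (cis x) = indicat_real A x *\<^sub>R H x"
      using AE_lborel_singleton[of pi] AE_lborel_singleton[of "- pi"] by auto
  qed
  finally show ?thesis by simp
qed

text \<open>Complements are harmless because the integral over the whole line, an open set, already
  vanishes. A closed interval is then the complement of an open set.\<close>

lemma orthogonal_borel:
  assumes "A \<in> sets borel"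
  shows "(LINT x:A|lborel. H x) = 0"
  using assms
proof (induction rule: borel_set_induct)
  have set_int: "set_integrable lborel A H" if "A \<in> sets borel" for A
    using integrable that unfolding set_integrable_def by (intro integrable_mult_indicator) auto
  have compl: "(LINT x:- A|lborel. H x) = 0" if "A \<in> sets borel" "(LINT x:A|lborel. H x) = 0" for A
  proof -
    have "(LINT x:A \<union> - A|lborel. H x) = (LINT x:A|lborel. H x) + (LINT x:- A|lborel. H x)"
      using that by (intro set_integral_Un set_int) auto
    then show ?thesis using that orthogonal_open[of UNIV] by (simp add: Compl_partition)
  qed
  {
    fix A :: "real set" assume "A \<in> sets borel" "(LINT x:A|lborel. H x) = 0"
    then show "(LINT x:- A|lborel. H x) = 0" by (rule compl)
  next
    fix a b :: real
    show "(LINT x:{a..b}|lborel. H x) = 0"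
      using compl[of "- {a..b}"] orthogonal_open[of "- {a..b}"] by (simp add: open_Compl)
  next
    fix f :: "nat \<Rightarrow> real set"
    assume f: "disjoint_family f" "\<And>i. f i \<in> sets borel" "\<And>i. (LINT x:f i|lborel. H x) = 0"
    have "(LINT x:(\<Union>i. f i)|lborel. H x) = (\<Sum>i. LINT x:f i|lborel. H x)"
      using f(1) by (intro lebesgue_integral_countable_add set_int) (auto simp: f(2) disjoint_family_on_def)
    then show "(LINT x:(\<Union>i. f i)|lborel. H x) = 0" using f(3) by simp
  }
qed (simp add: set_lebesgue_integral_def)

text \<open>Real densities with equal integrals over all measurable sets agree almost everywhere,
  hence the split into real and imaginary part.\<close>

lemma orthogonal_AE_0: "AE x in lborel. H x = 0"
proof -
  have set_int: "set_integrable lborel A H" if "A \<in> sets lborel" for A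
    using integrable that unfolding set_integrable_def by (intro integrable_mult_indicator) auto
  have "AE x in lborel. Re (H x) = 0"
  proof (rule density_unique_real)
    fix A :: "real set" assume A: "A \<in> sets lborel"
    have "(LINT x:A|lborel. Re (H x)) = Re (LINT x:A|lborel. H x)"
      using set_int[OF A] unfolding set_lebesgue_integral_def set_integrable_def
      by (subst integral_Re[symmetric]) auto
    then show "(LINT x:A|lborel. Re (H x)) = (LINT x:A|lborel. 0)"
      using orthogonal_borel A by simp
  qed (use integrable in auto)
  moreover have "AE x in lborel. Im (H x) = 0"
  proof (rule density_unique_real)
    fix A :: "real set" assume A: "A \<in> sets lborel"
    have "(LINT x:A|lborel. Im (H x)) = Im (LINT x:A|lborel. H x)"
      using set_int[OF A] unfolding set_lebesgue_integral_def set_integrable_def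
      by (subst integral_Im[symmetric]) auto
    then show "(LINT x:A|lborel. Im (H x)) = (LINT x:A|lborel. 0)"
      using orthogonal_borel A by simp
  qed (use integrable in auto)
  ultimately show ?thesis by eventually_elim (simp add: complex_eq_iff)
qed

end

section \<open>Uniqueness of the representing function and the pointwise square\<close>

lemma set_integrable_mult_test:
  assumes "set_integrable lborel {-pi..pi} f" "\<phi> \<in> test_functions"
  shows "set_integrable lborel {-pi..pi} (\<lambda>x. f x * \<phi> x)"
proof -
  have "compact (\<phi> ` {-pi..pi})"
    by (intro compact_continuous_image test_functions_continuous assms) auto
  from compact_imp_bounded[OF this] obtain B where B: "\<And>x. x \<in> {-pi..pi} \<Longrightarrow> cmod (\<phi> x) \<le> B"
    by (metis bounded_iff imageI)
  have meas: "\<phi> \<in> borel_measurable borel"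
    by (intro borel_measurable_continuous_onI test_functions_continuous assms)
  show ?thesis unfolding set_integrable_def
  proof (rule Bochner_Integration.integrable_bound)
    show "integrable lborel (\<lambda>x. B * norm (indicat_real {-pi..pi} x *\<^sub>R f x))"
      using assms(1) unfolding set_integrable_def by (intro integrable_mult_right integrable_norm)
    have "(\<lambda>x. (indicat_real {-pi..pi} x *\<^sub>R f x) * \<phi> x) \<in> borel_measurable borel"
      using assms(1) meas unfolding set_integrable_def by (intro borel_measurable_times) auto
    then show "(\<lambda>x. indicat_real {-pi..pi} x *\<^sub>R (f x * \<phi> x)) \<in> borel_measurable lborel" by simp
    show "AE x in lborel. norm (indicat_real {-pi..pi} x *\<^sub>R (f x * \<phi> x))
        \<le> norm (B * norm (indicat_real {-pi..pi} x *\<^sub>R f x))"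
      using B by (auto simp: norm_mult mult.commute[of B] indicator_def intro!: AE_I2 mult_left_mono order_trans[OF _ abs_ge_self])
  qed
qed

text \<open>The difference of two representatives, cut off outside one period, is orthogonal to
  every trigonometric polynomial.\<close>

lemma represents_unique:
  assumes "represents f u" "represents g u"
  shows "AE x in lborel. x \<in> {-pi..pi} \<longrightarrow> f x = g x"
proof -
  note int = assms[unfolded represents_def, THEN conjunct1]
  let ?H = "\<lambda>x. indicat_real {-pi..pi} x *\<^sub>R (f x - g x)"
  have "AE x in lborel. ?H x = 0"
  proof (rule orthogonal_AE_0)
    show "integrable lborel ?H"
      using set_integral_diff(1)[OF int] by (simp add: set_integrable_def)
    fix p assume p: "p \<in> trigpoly"
    note p = trigpoly_test_functions[OF p]
    have "(LINT x|lborel. ?H x * p x) = (LINT x:{-pi..pi}|lborel. f x * p x - g x * p x)"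
      unfolding set_lebesgue_integral_def by (simp add: algebra_simps)
    also have "\<dots> = (LINT x:{-pi..pi}|lborel. f x * p x) - (LINT x:{-pi..pi}|lborel. g x * p x)"
      by (intro set_integral_diff set_integrable_mult_test int p)
    also have "\<dots> = 0" using assms p by (simp add: represents_def)
    finally show "(LINT x|lborel. ?H x * p x) = 0" .
  qed auto
  then show ?thesis by eventually_elim (auto simp: indicator_def)
qed

text \<open>Discharges the definite description: another representative of \<open>u\<close> equals
  \<open>f\<close> almost everywhere on the period, so its square has the same pairings.\<close>

lemma dist_square_eqI:
  assumes f: "represents f u" "represents (\<lambda>x. (f x)\<^sup>2) w"
  shows "dist_square u = w"
  unfolding dist_square_def
proof (rule the_equality)
  show "\<exists>f. represents f u \<and> represents (\<lambda>x. (f x)\<^sup>2) w" using f by blast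
  fix w' assume "\<exists>g. represents g u \<and> represents (\<lambda>x. (g x)\<^sup>2) w'"
  then obtain g where g: "represents g u" "represents (\<lambda>x. (g x)\<^sup>2) w'" by blast
  have "pairing w' \<phi> = pairing w \<phi>" for \<phi>
  proof (cases "\<phi> \<in> test_functions")
    case True
    have meas: "(\<lambda>x. indicat_real {-pi..pi} x *\<^sub>R ((h x)\<^sup>2 * \<phi> x)) \<in> borel_measurable lborel"
      if "represents (\<lambda>x. (h x)\<^sup>2) v" for h v
      using set_integrable_mult_test[OF _ True, of "\<lambda>x. (h x)\<^sup>2"] that
      unfolding represents_def set_integrable_def by auto
    have "(LINT x:{-pi..pi}|lborel. (g x)\<^sup>2 * \<phi> x) = (LINT x:{-pi..pi}|lborel. (f x)\<^sup>2 * \<phi> x)"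
      unfolding set_lebesgue_integral_def
      using represents_unique[OF f(1) g(1)]
      by (intro Bochner_Integration.integral_cong_AE meas[OF f(2)] meas[OF g(2)]) (auto simp: indicator_def elim: eventually_mono)
    then show ?thesis using f(2) g(2) True by (simp add: represents_def)
  qed (simp add: pairing_outside)
  then show "w' = w" by (simp add: pairing_inject[symmetric] fun_eq_iff)
qed

section \<open>Absolutely convergent Fourier series\<close>

definition synth :: "(int \<Rightarrow> complex) \<Rightarrow> real \<Rightarrow> complex" where
  "synth a x = (\<Sum>\<^sub>\<infinity>k. a k * cis (of_int k * x))"

text \<open>The value of \<open>Abs_per_dist\<close> is meaningful once the functional is known to
  be a distribution; \<open>pairing_dist_of\<close> shows this for \<open>f\<close> continuous on
  the period, where the gauge integral agrees with the Lebesgue integral in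
  \<open>represents\<close>.\<close>

definition dist_of :: "(real \<Rightarrow> complex) \<Rightarrow> per_dist" where
  "dist_of f = Abs_per_dist (\<lambda>\<phi>. if \<phi> \<in> test_functions then integral {-pi..pi} (\<lambda>x. f x * \<phi> x) else 0)"

lemma norm_integral_period_le:
  assumes "continuous_on {-pi..pi} f" "\<And>x. x \<in> {-pi..pi} \<Longrightarrow> cmod (f x) \<le> B"
  shows "cmod (integral {-pi..pi} f) \<le> 2 * pi * B"
  using integral_bound[of "- pi" pi f B] assms by (simp add: mult_ac)

lemma continuous_interval_bounded:
  assumes "continuous_on {a..b :: real} f"
  obtains B where "B \<ge> 0" "\<And>x. x \<in> {a..b} \<Longrightarrow> norm (f x :: 'a :: real_normed_vector) \<le> B"
proof -
  have "bounded (f ` {a..b})"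
    by (intro compact_imp_bounded compact_continuous_image assms) auto
  then obtain B where "\<And>x. x \<in> {a..b} \<Longrightarrow> norm (f x) \<le> B" by (metis bounded_iff imageI)
  then show ?thesis using that[of "max B 0"] by fastforce
qed

lemma pairing_dist_of:
  assumes cont: "continuous_on {-pi..pi} f"
  shows "pairing (dist_of f) \<phi> = (if \<phi> \<in> test_functions then integral {-pi..pi} (\<lambda>x. f x * \<phi> x) else 0)"
proof -
  let ?F = "\<lambda>\<phi>. if \<phi> \<in> test_functions then integral {-pi..pi} (\<lambda>x. f x * \<phi> x) else 0"
  obtain M where M: "M \<ge> 0" "\<And>x. x \<in> {-pi..pi} \<Longrightarrow> cmod (f x) \<le> M"
    using continuous_interval_bounded[OF cont] by blast
  have cont': "continuous_on {-pi..pi} (\<lambda>x. f x * \<phi> x)" if "\<phi> \<in> test_functions" for \<phi>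
    by (intro continuous_intros cont test_functions_continuous that)
  have add: "?F (\<lambda>x. \<phi> x + \<psi> x) = ?F \<phi> + ?F \<psi>" if "\<phi> \<in> test_functions" "\<psi> \<in> test_functions" for \<phi> \<psi>
    using that test_functions_add(1)[OF that]
      integral_add[OF integrable_continuous_interval integrable_continuous_interval, OF cont'[OF that(1)] cont'[OF that(2)]]
    by (simp add: distrib_left)
  have cmult: "?F (\<lambda>x. c * \<phi> x) = c * ?F \<phi>" if "\<phi> \<in> test_functions" for c \<phi>
    using that test_functions_cmult(1)[OF that, of c] by (simp add: mult.left_commute[of _ c])
  have bound: "cmod (?F \<phi>) \<le> (2 * pi * M) * B"
    if "\<phi> \<in> test_functions" "\<forall>j\<le>0. \<forall>x. cmod (vderiv j \<phi> x) \<le> B" for \<phi> B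
  proof -
    have "cmod (f x * \<phi> x) \<le> M * B" if "x \<in> {-pi..pi}" for x
      using that M \<open>\<forall>j\<le>0. _\<close> by (simp add: norm_mult mult_mono)
    then show ?thesis
      using norm_integral_period_le[OF cont'[OF that(1)], of "M * B"] that(1) by (simp add: mult.assoc)
  qed
  have "?F \<in> {F. (\<forall>\<phi>\<in>test_functions. \<forall>\<psi>\<in>test_functions. F (\<lambda>x. \<phi> x + \<psi> x) = F \<phi> + F \<psi>) \<and>
      (\<forall>c. \<forall>\<phi>\<in>test_functions. F (\<lambda>x. c * \<phi> x) = c * F \<phi>) \<and>
      (\<exists>C N. \<forall>\<phi>\<in>test_functions. \<forall>B.
          (\<forall>j\<le>N. \<forall>x. cmod (vderiv j \<phi> x) \<le> B) \<longrightarrow> cmod (F \<phi>) \<le> C * B) \<and>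
      (\<forall>\<phi>. \<phi> \<notin> test_functions \<longrightarrow> F \<phi> = 0)}"
    unfolding mem_Collect_eq
  proof (intro conjI ballI allI)
    \<comment> \<open>Integration against a bounded function has order 0: no derivative of the test
      function enters, so N = 0.\<close>
    show "\<exists>C N. \<forall>\<phi>\<in>test_functions. \<forall>B. (\<forall>j\<le>N. \<forall>x. cmod (vderiv j \<phi> x) \<le> B) \<longrightarrow> cmod (?F \<phi>) \<le> C * B"
      using bound by (intro exI[of _ "2 * pi * M"] exI[of _ "0::nat"]) blast
  qed (simp_all only: add cmult if_False simp_thms not_False_eq_True, simp)
  then show ?thesis unfolding dist_of_def by (simp add: Abs_per_dist_inverse)
qed

lemma represents_dist_of:
  assumes "continuous_on {-pi..pi} f"
  shows "represents f (dist_of f)"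
proof -
  have "(LINT x:{-pi..pi}|lborel. f x * \<phi> x) = integral {-pi..pi} (\<lambda>x. f x * \<phi> x)" if "\<phi> \<in> test_functions" for \<phi>
    by (intro set_borel_integral_eq_integral borel_integrable_atLeastAtMost' continuous_intros assms
        test_functions_continuous that)
  then show ?thesis
    by (simp add: represents_def pairing_dist_of assms borel_integrable_atLeastAtMost')
qed

lemma fourier_coeff_dist_of:
  assumes "continuous_on {-pi..pi} f"
  shows "fourier_coeff (dist_of f) k = integral {-pi..pi} (\<lambda>x. cis (of_int (- k) * x) * f x) / of_real (2 * pi)"
  using test_functions_monomial[of 1 "- k"] fourier_coeff_pairing[of "dist_of f" k]
  by (simp add: pairing_dist_of[OF assms] field_simps)

lemma integral_cis_period:
  "integral {-pi..pi} (\<lambda>x. cis (of_int k * x)) = (if k = 0 then of_real (2 * pi) else 0)"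
proof (cases "k = 0")
  case False
  let ?F = "\<lambda>x. cis (of_int k * x) / (\<i> * of_int k)"
  have "((\<lambda>x. cis (of_int k * x)) has_integral ?F pi - ?F (- pi)) {-pi..pi}"
  proof (rule fundamental_theorem_of_calculus)
    fix x
    show "(?F has_vector_derivative cis (of_int k * x)) (at x within {-pi..pi})"
      using False unfolding has_vector_derivative_def
      by (auto intro!: derivative_eq_intros simp: fun_eq_iff scaleR_conv_of_real field_simps)
  qed auto
  moreover have "?F pi = ?F (- pi)"
    using test_functions_periodic[OF test_functions_monomial[of 1 k], of "- pi"] by simp
  ultimately show ?thesis using False by (simp add: integral_unique)
qed (simp add: scaleR_conv_of_real)

context
  fixes a :: "int \<Rightarrow> complex"
  assumes summable: "(\<lambda>k. cmod (a k)) summable_on UNIV"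
begin

lemma synth_uniform_limit:
  "uniform_limit A (\<lambda>F x. \<Sum>k\<in>F. a k * cis (of_int k * x)) (synth a) (finite_subsets_at_top UNIV)"
  unfolding synth_def
  by (rule Weierstrass_m_test_general[OF _ summable]) (simp add: norm_mult)

lemma continuous_on_synth [continuous_intros]: "continuous_on A (synth a)"
  by (rule uniform_limit_theorem[OF _ synth_uniform_limit])
     (auto intro!: always_eventually continuous_intros)

lemma norm_synth_le: "cmod (synth a x) \<le> (\<Sum>\<^sub>\<infinity>k. cmod (a k))"
proof -
  have "cmod (synth a x) \<le> (\<Sum>\<^sub>\<infinity>k. cmod (a k * cis (of_int k * x)))"
    unfolding synth_def by (rule norm_infsum_bound) (simp add: norm_mult summable)
  then show ?thesis by (simp add: norm_mult)
qed

text \<open>Summable coefficients give uniform convergence, which permits termwise integration. With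
  \<open>g\<close> an exponential this yields the coefficients of the sum, and with \<open>g\<close>
  the sum times an exponential it yields those of its square.\<close>

lemma has_sum_integral_synth:
  assumes "continuous_on {-pi..pi} g"
  shows "((\<lambda>k. a k * integral {-pi..pi} (\<lambda>x. cis (of_int k * x) * g x)) has_sum
          integral {-pi..pi} (\<lambda>x. synth a x * g x)) UNIV"
proof -
  obtain M where M: "M \<ge> 0" "\<And>x. x \<in> {-pi..pi} \<Longrightarrow> cmod (g x) \<le> M"
    using continuous_interval_bounded[OF assms] by blast
  let ?f = "\<lambda>k x. a k * (cis (of_int k * x) * g x)"
  have cont: "continuous_on {-pi..pi} (?f k)" "continuous_on {-pi..pi} (\<lambda>x. cis (of_int k * x) * g x)" for k
    by (intro continuous_intros assms)+
  have synth_eq: "synth a x * g x = (\<Sum>\<^sub>\<infinity>k. ?f k x)" for x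
    unfolding synth_def by (simp add: infsum_cmult_left' mult.assoc[symmetric])
  have "uniform_limit {-pi..pi} (\<lambda>F x. \<Sum>k\<in>F. ?f k x) (\<lambda>x. synth a x * g x) (finite_subsets_at_top UNIV)"
    unfolding synth_eq
  proof (rule Weierstrass_m_test_general)
    show "(\<lambda>k. cmod (a k) * M) summable_on UNIV" by (intro summable_on_cmult_left summable)
    show "norm (?f k x) \<le> cmod (a k) * M" if "x \<in> {-pi..pi}" for k x
      using M(2)[OF that] by (simp add: norm_mult mult_left_mono)
  qed
  then obtain I J where I: "\<And>F. ((\<lambda>x. \<Sum>k\<in>F. ?f k x) has_integral I F) {-pi..pi}"
    and J: "((\<lambda>x. synth a x * g x) has_integral J) {-pi..pi}"
    and lim: "(I \<longlongrightarrow> J) (finite_subsets_at_top UNIV)"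
    by (rule uniform_limit_integral) (auto intro!: continuous_on_sum cont)
  have "I F = (\<Sum>k\<in>F. a k * integral {-pi..pi} (\<lambda>x. cis (of_int k * x) * g x))" if "finite F" for F
    using integral_unique[OF I[of F]] that
    by (simp add: integral_sum integrable_continuous_interval cont)
  then have "(sum (\<lambda>k. a k * integral {-pi..pi} (\<lambda>x. cis (of_int k * x) * g x)) \<longlongrightarrow> J) (finite_subsets_at_top UNIV)"
    by (intro Lim_transform_eventually[OF lim] eventually_finite_subsets_at_top_weakI) simp
  then show ?thesis using integral_unique[OF J] by (simp add: has_sum_def)
qed

lemma fourier_coeff_synth: "fourier_coeff (dist_of (synth a)) k = a k"
proof -
  have "((\<lambda>j. a j * integral {-pi..pi} (\<lambda>x. cis (of_int j * x) * cis (of_int (- k) * x))) has_sum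
          integral {-pi..pi} (\<lambda>x. synth a x * cis (of_int (- k) * x))) UNIV"
    by (intro has_sum_integral_synth continuous_intros)
  also have "(\<lambda>j. a j * integral {-pi..pi} (\<lambda>x. cis (of_int j * x) * cis (of_int (- k) * x))) =
      (\<lambda>j. if j = k then a k * of_real (2 * pi) else 0)"
  proof
    fix j
    have "(\<lambda>x. cis (of_int j * x) * cis (of_int (- k) * x)) = (\<lambda>x. cis (of_int (j - k) * x))"
      by (simp add: cis_mult algebra_simps)
    then show "a j * integral {-pi..pi} (\<lambda>x. cis (of_int j * x) * cis (of_int (- k) * x)) =
      (if j = k then a k * of_real (2 * pi) else 0)"
      by (simp only: integral_cis_period) simp
  qed
  finally have "((\<lambda>j. if j = k then a k * of_real (2 * pi) else 0) has_sum
          integral {-pi..pi} (\<lambda>x. synth a x * cis (of_int (- k) * x))) UNIV" .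
  moreover have "((\<lambda>j. if j = k then a k * of_real (2 * pi) else 0) has_sum (a k * of_real (2 * pi))) UNIV"
    by (rule has_sum_finite_neutralI[where B = "{k}"]) auto
  ultimately have "integral {-pi..pi} (\<lambda>x. synth a x * cis (of_int (- k) * x)) = a k * of_real (2 * pi)"
    by (rule has_sum_unique)
  then show ?thesis
    by (subst fourier_coeff_dist_of) (auto intro!: continuous_intros simp: mult.commute)
qed

text \<open>Only one of the two factors is expanded. The integral of its j-th term against the other
  factor is the coefficient k - j, so no double series has to be rearranged.\<close>

lemma fourier_coeff_synth_square:
  "((\<lambda>j. a j * a (k - j)) has_sum fourier_coeff (dist_of (\<lambda>x. (synth a x)\<^sup>2)) k) UNIV"
proof -
  let ?g = "\<lambda>x. synth a x * cis (of_int (- k) * x)"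
  have *: "integral {-pi..pi} (\<lambda>x. cis (of_int j * x) * ?g x) = of_real (2 * pi) * a (k - j)" for j
  proof -
    have "(\<lambda>x. cis (of_int j * x) * ?g x) = (\<lambda>x. cis (of_int (- (k - j)) * x) * synth a x)"
      by (auto simp: fun_eq_iff mult.left_commute[of _ "synth a _"] cis_mult algebra_simps)
    then show ?thesis
      using fourier_coeff_synth[of "k - j"]
      by (subst (asm) fourier_coeff_dist_of) (auto intro!: continuous_intros simp: field_simps)
  qed
  have "((\<lambda>j. a j * (of_real (2 * pi) * a (k - j))) has_sum integral {-pi..pi} (\<lambda>x. synth a x * ?g x)) UNIV"
  proof -
    have "continuous_on {-pi..pi} ?g" by (intro continuous_intros)
    from has_sum_integral_synth[OF this] show ?thesis unfolding * .
  qed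
  then have "((\<lambda>j. a j * (of_real (2 * pi) * a (k - j)) * (1 / of_real (2 * pi))) has_sum
     (integral {-pi..pi} (\<lambda>x. synth a x * ?g x)) * (1 / of_real (2 * pi))) UNIV"
    by (rule has_sum_cmult_left)
  moreover have "(\<lambda>x. synth a x * ?g x) = (\<lambda>x. cis (of_int (- k) * x) * (synth a x)\<^sup>2)"
    by (simp add: power2_eq_square mult_ac)
  ultimately show ?thesis
    by (subst fourier_coeff_dist_of) (auto intro!: continuous_intros)
qed

end

lemma dist_of_synth_coeff:
  assumes "(\<lambda>k. cmod (fourier_coeff u k)) summable_on UNIV"
  shows "dist_of (synth (fourier_coeff u)) = u"
  by (intro per_dist_eqI fourier_coeff_synth assms)

lemma fourier_coeff_dist_square:
  assumes "(\<lambda>k. cmod (fourier_coeff u k)) summable_on UNIV"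
  shows "((\<lambda>j. fourier_coeff u j * fourier_coeff u (k - j)) has_sum fourier_coeff (dist_square u) k) UNIV"
proof -
  let ?f = "synth (fourier_coeff u)"
  have "dist_square u = dist_of (\<lambda>x. (?f x)\<^sup>2)"
    using represents_dist_of[of ?f] represents_dist_of[of "\<lambda>x. (?f x)\<^sup>2"] dist_of_synth_coeff[OF assms]
    by (intro dist_square_eqI) (auto intro!: continuous_intros assms)
  then show ?thesis using fourier_coeff_synth_square[OF assms] by simp
qed

text \<open>Summability lets the product sequence be synthesised, which is the existence half of the
  definite description; the other half is \<open>per_dist_eqI\<close>.\<close>

lemma fourier_coeff_multiplier:
  assumes "(\<lambda>k. cmod (m k * fourier_coeff v k)) summable_on UNIV"
  shows "fourier_coeff (fourier_multiplier m v) k = m k * fourier_coeff v k"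
proof -
  have "\<exists>!w. \<forall>n. fourier_coeff w n = m n * fourier_coeff v n"
    using fourier_coeff_synth[OF assms] by (intro ex1I[of _ "dist_of (synth (\<lambda>k. m k * fourier_coeff v k))"])
      (auto intro: per_dist_eqI)
  from theI'[OF this] show ?thesis unfolding fourier_multiplier_def by blast
qed

text \<open>Such a distribution is a continuous function bounded by the sum of its absolute
  coefficients, so the supremum of the test function suffices.\<close>

lemma pairing_summable_bound:
  assumes "(\<lambda>k. cmod (fourier_coeff u k)) summable_on UNIV"
    and "\<phi> \<in> test_functions" "\<And>x. cmod (\<phi> x) \<le> B"
  shows "cmod (pairing u \<phi>) \<le> 2 * pi * ((\<Sum>\<^sub>\<infinity>k. cmod (fourier_coeff u k)) * B)"
proof -
  let ?f = "synth (fourier_coeff u)"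
  have "pairing u \<phi> = integral {-pi..pi} (\<lambda>x. ?f x * \<phi> x)"
    using pairing_dist_of[OF continuous_on_synth[OF assms(1)], of \<phi>] dist_of_synth_coeff[OF assms(1)] assms(2) by simp
  also have "cmod \<dots> \<le> 2 * pi * ((\<Sum>\<^sub>\<infinity>k. cmod (fourier_coeff u k)) * B)"
  proof (rule norm_integral_period_le)
    show "continuous_on {- pi..pi} (\<lambda>x. ?f x * \<phi> x)"
      by (intro continuous_intros test_functions_continuous assms)
    show "cmod (?f x * \<phi> x) \<le> (\<Sum>\<^sub>\<infinity>k. cmod (fourier_coeff u k)) * B" for x
      unfolding norm_mult by (intro mult_mono norm_synth_le assms infsum_nonneg) auto
  qed
  finally show ?thesis .
qed

text \<open>The pairings with cos (k x) and sin (k x) are real, and the exponentials of frequency k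
  and - k are their two conjugate combinations.\<close>

lemma real_valued_fourier_coeff:
  assumes "real_valued u"
  shows "fourier_coeff u (- k) = cnj (fourier_coeff u k)"
proof -
  let ?c = "\<lambda>x. complex_of_real (cos (of_int k * x))" and ?s = "\<lambda>x. complex_of_real (sin (of_int k * x))"
  have test: "?c \<in> test_functions" "?s \<in> test_functions"
    by (intro trigpoly_test_functions trigpoly_cos trigpoly_sin)+
  have "pairing u ?c \<in> \<real>" "pairing u ?s \<in> \<real>"
    using assms test unfolding real_valued_def by auto
  moreover have "pairing u (\<lambda>x. cis (of_int k * x)) = pairing u ?c + \<i> * pairing u ?s"
  proof -
    have "(\<lambda>x. cis (of_int k * x)) = (\<lambda>x. ?c x + \<i> * ?s x)" by (simp add: fun_eq_iff complex_eq_iff)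
    then show ?thesis
      using pairing_add[OF test(1) test_functions_cmult(1)[OF test(2), of \<i>], of u] pairing_cmult[OF test(2), of u \<i>] by simp
  qed
  moreover have "pairing u (\<lambda>x. cis (of_int (- k) * x)) = pairing u ?c + (- \<i>) * pairing u ?s"
  proof -
    have "(\<lambda>x. cis (of_int (- k) * x)) = (\<lambda>x. ?c x + (- \<i>) * ?s x)" by (simp add: fun_eq_iff complex_eq_iff)
    then show ?thesis
      using pairing_add[OF test(1) test_functions_cmult(1)[OF test(2), of "- \<i>"], of u] pairing_cmult[OF test(2), of u "- \<i>"] by simp
  qed
  ultimately have "pairing u (\<lambda>x. cis (of_int k * x)) = cnj (pairing u (\<lambda>x. cis (of_int (- k) * x)))"
    by (simp add: Reals_cnj_iff)
  then show ?thesis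
    using fourier_coeff_pairing[of u k] fourier_coeff_pairing[of u "- k"] by simp
qed

text \<open>Conjugating the series and exchanging k with - k reproduces it, so the continuous
  function behind \<open>u\<close> is real.\<close>

lemma real_valuedI:
  assumes "(\<lambda>k. cmod (fourier_coeff u k)) summable_on UNIV"
    and herm: "\<And>k. fourier_coeff u (- k) = cnj (fourier_coeff u k)"
  shows "real_valued u"
  unfolding real_valued_def
proof (intro ballI impI)
  fix \<phi> assume \<phi>: "\<phi> \<in> test_functions" "\<forall>x. \<phi> x \<in> \<real>"
  let ?f = "synth (fourier_coeff u)"
  have "cnj (?f x) = ?f x" for x
  proof -
    have "cnj (?f x) = (\<Sum>\<^sub>\<infinity>k. cnj (fourier_coeff u k * cis (of_int k * x)))"
      unfolding synth_def by (rule infsum_cnj[symmetric])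
    also have "\<dots> = (\<Sum>\<^sub>\<infinity>k. fourier_coeff u (- k) * cis (of_int (- k) * x))"
      by (simp add: herm cis_cnj)
    also have "\<dots> = ?f x"
      unfolding synth_def by (rule infsum_reindex_bij_witness[of _ uminus uminus]) auto
    finally show ?thesis .
  qed
  then have *: "cnj (?f x * \<phi> x) = ?f x * \<phi> x" for x
    using \<phi>(2) by (simp add: Reals_cnj_iff)
  have "pairing u \<phi> = integral {-pi..pi} (\<lambda>x. ?f x * \<phi> x)"
    using pairing_dist_of[OF continuous_on_synth[OF assms(1)], of \<phi>] dist_of_synth_coeff[OF assms(1)] \<phi>(1) by simp
  also have "cnj \<dots> = integral {-pi..pi} (\<lambda>x. cnj (?f x * \<phi> x))"
    by (rule integral_cnj)
  finally show "pairing u \<phi> \<in> \<real>"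
    unfolding * by (simp add: Reals_cnj_iff \<open>pairing u \<phi> = _\<close>)
qed

section \<open>Linear structure seen on coefficients\<close>

lemma fourier_coeff_add: "fourier_coeff (u + v) k = fourier_coeff u k + fourier_coeff v k"
  by (simp add: fourier_coeff_def plus_per_dist.rep_eq distrib_left)

lemma fourier_coeff_scaleR: "fourier_coeff (c *\<^sub>R u) k = c *\<^sub>R fourier_coeff u k"
  by (simp add: fourier_coeff_def scaleR_per_dist.rep_eq)

lemma fourier_coeff_diff: "fourier_coeff (u - v) k = fourier_coeff u k - fourier_coeff v k"
  using fourier_coeff_add[of "u - v" v k] by simp

lemma fourier_coeff_0: "fourier_coeff 0 k = 0"
  by (simp add: fourier_coeff_def zero_per_dist.rep_eq)

lemma real_valued_add: "real_valued u \<Longrightarrow> real_valued v \<Longrightarrow> real_valued (u + v)"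
  by (simp add: real_valued_def plus_per_dist.rep_eq)

lemma real_valued_scaleR: "real_valued u \<Longrightarrow> real_valued (c *\<^sub>R u)"
  by (simp add: real_valued_def scaleR_per_dist.rep_eq scaleR_conv_of_real)

lemma real_valued_diff: "real_valued u \<Longrightarrow> real_valued v \<Longrightarrow> real_valued (u - v)"
  using real_valued_add[of u "(-1) *\<^sub>R v"] real_valued_scaleR[of v "-1"] by simp

lemma real_valued_0: "real_valued 0"
  by (simp add: real_valued_def zero_per_dist.rep_eq)

section \<open>Square summable families\<close>

lemma L2_set_le_infsum:
  fixes f :: "'i \<Rightarrow> real"
  assumes "(\<lambda>k. (f k)\<^sup>2) summable_on UNIV"
  shows "L2_set f S \<le> sqrt (\<Sum>\<^sub>\<infinity>k. (f k)\<^sup>2)"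
\<comment> \<open>For infinite \<open>S\<close> the finite sum in \<open>L2_set\<close> is 0 by
  convention.\<close>
proof (cases "finite S")
  case True
  then show ?thesis
    unfolding L2_set_def by (intro real_sqrt_le_mono finite_sum_le_infsum assms) auto
qed (simp add: infsum_nonneg)

text \<open>The form in which membership and norm bounds are obtained below: a uniform bound on
  finite sections, where the inequalities for \<open>L2_set\<close> apply.\<close>

lemma square_summable_L2_set:
  fixes f :: "'i \<Rightarrow> real"
  assumes "\<And>S. finite S \<Longrightarrow> L2_set f S \<le> C"
  shows "(\<lambda>k. (f k)\<^sup>2) summable_on UNIV" "sqrt (\<Sum>\<^sub>\<infinity>k. (f k)\<^sup>2) \<le> C"
proof -
  have C: "C \<ge> 0" using assms[of "{}"] by simp
  have le: "(\<Sum>k\<in>S. (f k)\<^sup>2) \<le> C\<^sup>2" if "finite S" for S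
    using assms[OF that] C unfolding L2_set_def by (simp add: real_le_lsqrt sqrt_le_D)
  show summ: "(\<lambda>k. (f k)\<^sup>2) summable_on UNIV"
    by (rule nonneg_bdd_above_summable_on) (auto intro!: bdd_aboveI2[where M = "C\<^sup>2"] le)
  show "sqrt (\<Sum>\<^sub>\<infinity>k. (f k)\<^sup>2) \<le> C"
    using C by (intro real_le_lsqrt infsum_le_finite_sums summ le) auto
qed

lemma Cauchy_Schwarz_infsum:
  fixes f g :: "'i \<Rightarrow> real"
  assumes "(\<lambda>k. (f k)\<^sup>2) summable_on UNIV" "(\<lambda>k. (g k)\<^sup>2) summable_on UNIV"
  shows "(\<lambda>k. \<bar>f k * g k\<bar>) summable_on UNIV"
    and "(\<Sum>\<^sub>\<infinity>k. \<bar>f k * g k\<bar>) \<le> sqrt (\<Sum>\<^sub>\<infinity>k. (f k)\<^sup>2) * sqrt (\<Sum>\<^sub>\<infinity>k. (g k)\<^sup>2)"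
proof -
  have le: "(\<Sum>k\<in>S. \<bar>f k * g k\<bar>) \<le> sqrt (\<Sum>\<^sub>\<infinity>k. (f k)\<^sup>2) * sqrt (\<Sum>\<^sub>\<infinity>k. (g k)\<^sup>2)" for S
    using order_trans[OF L2_set_mult_ineq mult_mono[OF L2_set_le_infsum[OF assms(1), of S] L2_set_le_infsum[OF assms(2), of S]]]
    by (simp add: abs_mult infsum_nonneg)
  show summ: "(\<lambda>k. \<bar>f k * g k\<bar>) summable_on UNIV"
    by (rule nonneg_bdd_above_summable_on) (auto intro!: bdd_aboveI2 le)
  show "(\<Sum>\<^sub>\<infinity>k. \<bar>f k * g k\<bar>) \<le> sqrt (\<Sum>\<^sub>\<infinity>k. (f k)\<^sup>2) * sqrt (\<Sum>\<^sub>\<infinity>k. (g k)\<^sup>2)"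
    by (intro infsum_le_finite_sums summ le)
qed

lemma has_sum_finite_sum:
  fixes f :: "'k \<Rightarrow> 'i \<Rightarrow> 'a :: topological_comm_monoid_add"
  assumes "finite S" "\<And>k. k \<in> S \<Longrightarrow> (f k has_sum x k) A"
  shows "((\<lambda>j. \<Sum>k\<in>S. f k j) has_sum (\<Sum>k\<in>S. x k)) A"
  using assms by (induction rule: finite_induct) (auto intro: has_sum_add)

section \<open>Weighted sequence spaces\<close>

text \<open>The factor 2 pi is absorbed so that \<open>seq_norm s\<close> of the Fourier
  coefficients is exactly the Sobolev norm; the square root makes the weight multiply the
  coefficients themselves.\<close>

definition weight :: "real \<Rightarrow> int \<Rightarrow> real" where
  "weight s k = sqrt (2 * pi * (1 + (real_of_int \<bar>k\<bar>)\<^sup>2) powr s)"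

definition seq_space :: "real \<Rightarrow> (int \<Rightarrow> complex) set" where
  "seq_space s = {a. (\<lambda>k. (weight s k * cmod (a k))\<^sup>2) summable_on UNIV}"

definition seq_norm :: "real \<Rightarrow> (int \<Rightarrow> complex) \<Rightarrow> real" where
  "seq_norm s a = sqrt (\<Sum>\<^sub>\<infinity>k. (weight s k * cmod (a k))\<^sup>2)"

lemma weight_pos: "weight s k > 0"
proof -
  have "1 + (real_of_int \<bar>k\<bar>)\<^sup>2 > 0" by (intro add_pos_nonneg) auto
  then show ?thesis by (simp add: weight_def)
qed

lemma weight_sq: "(weight s k)\<^sup>2 = 2 * pi * (1 + (real_of_int \<bar>k\<bar>)\<^sup>2) powr s"
  by (simp add: weight_def)

text \<open>From k = j + (k - j) one gets 1 + k^2 at most 4 times the larger of 1 + j^2 and 1 + (k -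
  j)^2. Raising to the power s produces the factor 4^s, and the maximum is bounded by the
  sum.\<close>

lemma weight_sq_subadditive:
  assumes "s \<ge> 0"
  shows "(weight s k)\<^sup>2 \<le> 4 powr s * ((weight s j)\<^sup>2 + (weight s (k - j))\<^sup>2)"
proof -
  let ?f = "\<lambda>k. 1 + (real_of_int \<bar>k\<bar>)\<^sup>2"
  define m where "m = max (?f j) (?f (k - j))"
  have pos: "?f l > 0" for l by (intro add_pos_nonneg) auto
  have "(real_of_int k)\<^sup>2 \<le> 2 * (real_of_int j)\<^sup>2 + 2 * (real_of_int (k - j))\<^sup>2"
    using sum_squares_bound[of "real_of_int j" "real_of_int (k - j)"] by (simp add: power2_eq_square algebra_simps)
  then have "?f k \<le> 4 * m" unfolding m_def by (auto simp: max_def)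
  then have "?f k powr s \<le> (4 * m) powr s"
    using pos[of k] assms by (intro powr_mono2) auto
  also have "\<dots> = 4 powr s * m powr s"
    using pos by (intro powr_mult)
  also have "m powr s \<le> ?f j powr s + ?f (k - j) powr s"
    by (auto simp: m_def max_def)
  finally have "?f k powr s \<le> 4 powr s * (?f j powr s + ?f (k - j) powr s)" by simp
  from mult_left_mono[OF this, of "2 * pi"] show ?thesis
    unfolding weight_sq by (simp add: algebra_simps)
qed

text \<open>The exponent condition enters here: the terms decay like |k|^(- 2 s).\<close>

lemma summable_weight:
  assumes "s > 1 / 2"
  shows "(\<lambda>k. (1 / weight s k)\<^sup>2) summable_on UNIV"
proof -
  let ?g = "\<lambda>k. (1 / weight s k)\<^sup>2"
  have nat: "summable (\<lambda>n. ?g (int n))"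
  proof (rule summable_comparison_test_ev)
    show "summable (\<lambda>n. real n powr (- 2 * s))"
      using assms by (simp add: summable_real_powr_iff)
    \<comment> \<open>The comparison fails at n = 0, where \<open>powr\<close> returns 0.\<close>
    have "?g (int n) \<le> real n powr (- 2 * s)" if "n \<ge> 1" for n
    proof -
      have "real n powr (2 * s) = ((real n)\<^sup>2) powr s"
        using that by (simp add: powr_powr[symmetric] powr_numeral)
      also have "\<dots> \<le> (1 + (real n)\<^sup>2) powr s"
        using assms that by (intro powr_mono2) auto
      also have "\<dots> \<le> (weight s (int n))\<^sup>2"
        using pi_ge_two mult_right_mono[of 1 "2 * pi" "(1 + (real n)\<^sup>2) powr s"] by (simp add: weight_sq)
      finally have "real n powr (2 * s) \<le> (weight s (int n))\<^sup>2" .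
      then have "inverse ((weight s (int n))\<^sup>2) \<le> inverse (real n powr (2 * s))"
        using that by (intro le_imp_inverse_le) auto
      then show ?thesis by (simp add: powr_minus power_divide inverse_eq_divide)
    qed
    then show "eventually (\<lambda>n. norm (?g (int n)) \<le> real n powr (- 2 * s)) sequentially"
      by (intro eventually_sequentiallyI[of 1]) simp
  qed
  then have *: "(\<lambda>n. ?g (int n)) summable_on UNIV"
    by (simp add: summable_on_UNIV_nonneg_real_iff)
  have "?g summable_on range int"
    using * by (subst summable_on_reindex) (auto simp: o_def)
  moreover have "?g summable_on range (\<lambda>n. - int n)"
    using * by (subst summable_on_reindex) (auto simp: o_def weight_def inj_on_def)
  moreover have "range int \<union> range (\<lambda>n. - int n) = UNIV"
    by (auto, metis int_cases2 rangeI)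
  ultimately show ?thesis
    using summable_on_union[of ?g "range int" "range (\<lambda>n. - int n)"] by simp
qed

section \<open>Norm inequalities through finite sections\<close>

lemma seq_norm_nonneg: "0 \<le> seq_norm s a"
  by (simp add: seq_norm_def infsum_nonneg)

lemma L2_set_le_seq_norm:
  "a \<in> seq_space s \<Longrightarrow> L2_set (\<lambda>k. weight s k * cmod (a k)) S \<le> seq_norm s a"
  unfolding seq_space_def seq_norm_def by (auto intro: L2_set_le_infsum)

lemma seq_spaceI:
  assumes "\<And>S. finite S \<Longrightarrow> L2_set (\<lambda>k. weight s k * cmod (a k)) S \<le> C"
  shows "a \<in> seq_space s" "seq_norm s a \<le> C"
  using square_summable_L2_set[OF assms] by (auto simp: seq_space_def seq_norm_def)

lemma coeff_le_seq_norm: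
  assumes "a \<in> seq_space s"
  shows "weight s k * cmod (a k) \<le> seq_norm s a"
  using L2_set_le_seq_norm[OF assms, of "{k}"] weight_pos[of s k] by simp

lemma seq_space_mono:
  assumes "a \<in> seq_space s" "\<And>k. cmod (b k) \<le> cmod (a k)"
  shows "b \<in> seq_space s" "seq_norm s b \<le> seq_norm s a"
proof -
  have "L2_set (\<lambda>k. weight s k * cmod (b k)) S \<le> seq_norm s a" for S
    using weight_pos[of s]
    by (intro order_trans[OF L2_set_mono L2_set_le_seq_norm[OF assms(1)]])
       (auto intro!: mult_left_mono assms(2) simp: less_imp_le)
  then show "b \<in> seq_space s" "seq_norm s b \<le> seq_norm s a" by (auto intro: seq_spaceI)
qed

lemma seq_space_add:
  assumes "a \<in> seq_space s" "b \<in> seq_space s"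
  shows "(\<lambda>k. a k + b k) \<in> seq_space s" "seq_norm s (\<lambda>k. a k + b k) \<le> seq_norm s a + seq_norm s b"
proof -
  have "L2_set (\<lambda>k. weight s k * cmod (a k + b k)) S \<le> seq_norm s a + seq_norm s b" for S
  proof -
    have "L2_set (\<lambda>k. weight s k * cmod (a k + b k)) S \<le>
        L2_set (\<lambda>k. weight s k * cmod (a k) + weight s k * cmod (b k)) S"
      using weight_pos[of s]
      by (intro L2_set_mono) (auto simp: less_imp_le distrib_left[symmetric] intro!: mult_left_mono norm_triangle_ineq)
    also have "\<dots> \<le> L2_set (\<lambda>k. weight s k * cmod (a k)) S + L2_set (\<lambda>k. weight s k * cmod (b k)) S"
      by (rule L2_set_triangle_ineq)
    also have "\<dots> \<le> seq_norm s a + seq_norm s b"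
      by (intro add_mono L2_set_le_seq_norm assms)
    finally show ?thesis .
  qed
  then show "(\<lambda>k. a k + b k) \<in> seq_space s" "seq_norm s (\<lambda>k. a k + b k) \<le> seq_norm s a + seq_norm s b"
    by (auto intro: seq_spaceI)
qed

lemma seq_space_cmult:
  assumes "a \<in> seq_space s"
  shows "(\<lambda>k. c * a k) \<in> seq_space s" "seq_norm s (\<lambda>k. c * a k) \<le> cmod c * seq_norm s a"
proof -
  have "L2_set (\<lambda>k. weight s k * cmod (c * a k)) S \<le> cmod c * seq_norm s a" for S
    using mult_left_mono[OF L2_set_le_seq_norm[OF assms, of S], of "cmod c"]
    by (simp add: L2_set_right_distrib norm_mult mult.left_commute)
  then show "(\<lambda>k. c * a k) \<in> seq_space s" "seq_norm s (\<lambda>k. c * a k) \<le> cmod c * seq_norm s a"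
    by (auto intro: seq_spaceI)
qed

lemma seq_space_diff:
  assumes "a \<in> seq_space s" "b \<in> seq_space s"
  shows "(\<lambda>k. a k - b k) \<in> seq_space s"
  using seq_space_add(1)[OF assms(1) seq_space_cmult(1)[OF assms(2), of "-1"]] by simp

text \<open>The l2 norm of 1/w for the weight w. By Cauchy-Schwarz it is a constant for the
  embedding into absolutely summable sequences.\<close>

definition embed_const :: "real \<Rightarrow> real" where
  "embed_const s = sqrt (\<Sum>\<^sub>\<infinity>k. (1 / weight s k)\<^sup>2)"

lemma seq_space_abs_summable:
  assumes "s > 1 / 2" "a \<in> seq_space s"
  shows "(\<lambda>k. cmod (a k)) summable_on UNIV" "(\<Sum>\<^sub>\<infinity>k. cmod (a k)) \<le> embed_const s * seq_norm s a"
proof -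
  have eq: "\<bar>1 / weight s k * (weight s k * cmod (a k))\<bar> = cmod (a k)" for k
    using weight_pos[of s k] by simp
  note CS = Cauchy_Schwarz_infsum[OF summable_weight[OF assms(1)] assms(2)[unfolded seq_space_def mem_Collect_eq], unfolded eq]
  show "(\<lambda>k. cmod (a k)) summable_on UNIV" by (rule CS)
  show "(\<Sum>\<^sub>\<infinity>k. cmod (a k)) \<le> embed_const s * seq_norm s a"
    using CS(2) by (simp add: embed_const_def seq_norm_def)
qed

text \<open>The 4^s comes from \<open>weight_sq_subadditive\<close>. The 2 counts the terms 1/w_j^2
  and 1/w_(k-j)^2, each of which sums over j to the square of \<open>embed_const s\<close>.\<close>

definition algebra_const :: "real \<Rightarrow> real" where
  "algebra_const s = sqrt (2 * 4 powr s) * embed_const s"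

lemma algebra_const_nonneg: "0 \<le> algebra_const s"
  by (simp add: algebra_const_def embed_const_def infsum_nonneg)

text \<open>Writing \<open>w\<close> for the weight, Cauchy-Schwarz applied to
  \<open>w\<^sub>k a\<^sub>j b\<^sub>k\<^sub>-\<^sub>j = (w\<^sub>k / (w\<^sub>j w\<^sub>k\<^sub>-\<^sub>j)) (w\<^sub>j a\<^sub>j) (w\<^sub>k\<^sub>-\<^sub>j b\<^sub>k\<^sub>-\<^sub>j)\<close>
  leaves the sum of \<open>(w\<^sub>k / (w\<^sub>j w\<^sub>k\<^sub>-\<^sub>j))\<^sup>2\<close> over \<open>j\<close>, which is bounded uniformly in \<open>k\<close>.\<close>

lemma convolution_seq_space:
  assumes s: "s > 1 / 2" and a: "a \<in> seq_space s" and b: "b \<in> seq_space s"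
  shows "(\<lambda>j. a j * b (k - j)) summable_on UNIV"
    and "(\<lambda>k. \<Sum>\<^sub>\<infinity>j. a j * b (k - j)) \<in> seq_space s"
    and "seq_norm s (\<lambda>k. \<Sum>\<^sub>\<infinity>j. a j * b (k - j)) \<le> algebra_const s * seq_norm s a * seq_norm s b"
proof -
  let ?w = "weight s"
  define A where "A = (\<lambda>j. (?w j * cmod (a j))\<^sup>2)"
  define B where "B = (\<lambda>j. (?w j * cmod (b j))\<^sup>2)"
  define M where "M = 2 * 4 powr s * (embed_const s)\<^sup>2"
  have A: "A summable_on UNIV" "A j \<ge> 0" and B: "B summable_on UNIV" "B j \<ge> 0" for j
    using a b by (auto simp: A_def B_def seq_space_def)
  have norm_sq: "(seq_norm s a)\<^sup>2 = infsum A UNIV" "(seq_norm s b)\<^sup>2 = infsum B UNIV"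
    by (simp_all add: seq_norm_def A_def B_def infsum_nonneg)
  have inv: "(\<lambda>j. (1 / ?w j)\<^sup>2) summable_on UNIV" by (rule summable_weight[OF s])
  have inv_shift: "(\<lambda>j. (1 / ?w (k - j))\<^sup>2) summable_on UNIV" for k
    by (rule summable_on_reindex_bij_witness[of _ "\<lambda>j. k - j" "\<lambda>j. k - j", THEN iffD2, OF _ _ _ _ _ inv]) auto
  have inv_shift_sum: "(\<Sum>\<^sub>\<infinity>j. (1 / ?w (k - j))\<^sup>2) = (embed_const s)\<^sup>2" for k
    unfolding embed_const_def
    by (subst real_sqrt_pow2) (auto intro!: infsum_nonneg infsum_reindex_bij_witness[of _ "\<lambda>j. k - j" "\<lambda>j. k - j"])
  have inv_sum: "(\<Sum>\<^sub>\<infinity>j. (1 / ?w j)\<^sup>2) = (embed_const s)\<^sup>2"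
    using inv_shift_sum[of 0] by (simp add: weight_def)
  have B_le: "(\<Sum>k\<in>S. B (k - j)) \<le> infsum B UNIV" if "finite S" for S j
  proof -
    have "(\<Sum>k\<in>S. B (k - j)) = sum B ((\<lambda>k. k - j) ` S)"
      by (subst sum.reindex) (auto simp: inj_on_def)
    also have "\<dots> \<le> infsum B UNIV" using that B by (intro finite_sum_le_infsum) auto
    finally show ?thesis .
  qed
  have AB: "(\<lambda>j. A j * B (k - j)) summable_on UNIV" for k
  proof (rule summable_on_comparison_test)
    show "(\<lambda>j. A j * infsum B UNIV) summable_on UNIV" by (intro summable_on_cmult_left A)
    show "A j * B (k - j) \<le> A j * infsum B UNIV" for j
      using B_le[of "{k}" j] A by (intro mult_left_mono) auto
  qed (use A B in auto)
  have ratio: "(?w k / (?w j * ?w (k - j)))\<^sup>2 \<le> 4 powr s * ((1 / ?w (k - j))\<^sup>2 + (1 / ?w j)\<^sup>2)" for j k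
  proof -
    have pos: "?w j > 0" "?w (k - j) > 0" by (rule weight_pos)+
    have "(?w k / (?w j * ?w (k - j)))\<^sup>2 \<le> 4 powr s * ((?w j)\<^sup>2 + (?w (k - j))\<^sup>2) / (?w j * ?w (k - j))\<^sup>2"
      using s by (simp add: power_divide divide_right_mono weight_sq_subadditive)
    also have "\<dots> = 4 powr s * ((1 / ?w (k - j))\<^sup>2 + (1 / ?w j)\<^sup>2)"
      using pos by (simp add: field_simps power2_eq_square)
    finally show ?thesis .
  qed
  have ratio_summable: "(\<lambda>j. 4 powr s * ((1 / ?w (k - j))\<^sup>2 + (1 / ?w j)\<^sup>2)) summable_on UNIV" for k
    by (intro summable_on_cmult_right summable_on_add inv inv_shift)
  have R: "(\<lambda>j. (?w k / (?w j * ?w (k - j)))\<^sup>2) summable_on UNIV" for k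
    by (rule summable_on_comparison_test[OF ratio_summable ratio]) auto
  have R_le: "(\<Sum>\<^sub>\<infinity>j. (?w k / (?w j * ?w (k - j)))\<^sup>2) \<le> M" for k
  proof -
    have "(\<Sum>\<^sub>\<infinity>j. (?w k / (?w j * ?w (k - j)))\<^sup>2) \<le> (\<Sum>\<^sub>\<infinity>j. 4 powr s * ((1 / ?w (k - j))\<^sup>2 + (1 / ?w j)\<^sup>2))"
      by (intro infsum_mono R ratio_summable ratio)
    also have "\<dots> = M"
      by (simp only: infsum_cmult_right' infsum_add[OF inv_shift inv] inv_shift_sum inv_sum M_def) (simp add: algebra_simps)
    finally show ?thesis .
  qed
  have AB_sq: "A j * B (k - j) = (?w j * cmod (a j) * (?w (k - j) * cmod (b (k - j))))\<^sup>2" for j k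
    by (simp add: A_def B_def power_mult_distrib)
  have prod: "\<bar>?w k / (?w j * ?w (k - j)) * (?w j * cmod (a j) * (?w (k - j) * cmod (b (k - j))))\<bar>
      = ?w k * cmod (a j * b (k - j))" for j k
    using weight_pos[of s j] weight_pos[of s "k - j"] weight_pos[of s k] by (simp add: norm_mult abs_mult)
  have CS: "(\<lambda>j. ?w k * cmod (a j * b (k - j))) summable_on UNIV"
    "(\<Sum>\<^sub>\<infinity>j. ?w k * cmod (a j * b (k - j))) \<le>
      sqrt (\<Sum>\<^sub>\<infinity>j. (?w k / (?w j * ?w (k - j)))\<^sup>2) * sqrt (\<Sum>\<^sub>\<infinity>j. A j * B (k - j))" for k
    using Cauchy_Schwarz_infsum[OF R[of k] AB[of k, unfolded AB_sq]] unfolding prod AB_sq by auto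
  have abs: "(\<lambda>j. cmod (a j * b (k - j))) summable_on UNIV" for k
    using summable_on_cmult_right[OF CS(1)[of k], of "1 / ?w k"] weight_pos[of s k] by simp
  show "(\<lambda>j. a j * b (k - j)) summable_on UNIV" for k
    using abs by (rule abs_summable_summable)
  let ?c = "\<lambda>k. \<Sum>\<^sub>\<infinity>j. a j * b (k - j)"
  \<comment> \<open>Pointwise in k, Cauchy-Schwarz separates the uniformly bounded ratio sum from
    the convolution of the squared weighted sequences \<open>A\<close> and \<open>B\<close>.\<close>
  have c_le: "(?w k * cmod (?c k))\<^sup>2 \<le> M * (\<Sum>\<^sub>\<infinity>j. A j * B (k - j))" for k
  proof -
    have "?w k * cmod (?c k) \<le> ?w k * (\<Sum>\<^sub>\<infinity>j. cmod (a j * b (k - j)))"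
      using weight_pos[of s k] by (intro mult_left_mono norm_infsum_bound abs) auto
    also have "\<dots> = (\<Sum>\<^sub>\<infinity>j. ?w k * cmod (a j * b (k - j)))"
      by (rule infsum_cmult_right'[symmetric])
    also have "\<dots> \<le> sqrt (\<Sum>\<^sub>\<infinity>j. (?w k / (?w j * ?w (k - j)))\<^sup>2) * sqrt (\<Sum>\<^sub>\<infinity>j. A j * B (k - j))"
      by (rule CS(2))
    also have "\<dots> \<le> sqrt M * sqrt (\<Sum>\<^sub>\<infinity>j. A j * B (k - j))"
      by (intro mult_right_mono real_sqrt_le_mono R_le) (auto intro!: infsum_nonneg A B mult_nonneg_nonneg)
    also have "\<dots> = sqrt (M * (\<Sum>\<^sub>\<infinity>j. A j * B (k - j)))" by (simp add: real_sqrt_mult)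
    finally show ?thesis
      using weight_pos[of s k]
      by (intro sqrt_ge_absD) simp
  qed
  have "L2_set (\<lambda>k. ?w k * cmod (?c k)) S \<le> algebra_const s * seq_norm s a * seq_norm s b" if S: "finite S" for S
  proof -
    \<comment> \<open>With \<open>S\<close> finite, exchanging the two sums is mere additivity. For
      each j the inner sum over k is then at most \<open>A j\<close> times the total mass of
      \<open>B\<close>.\<close>
    have sum_S: "((\<lambda>j. \<Sum>k\<in>S. A j * B (k - j)) has_sum (\<Sum>k\<in>S. \<Sum>\<^sub>\<infinity>j. A j * B (k - j))) UNIV"
      by (intro has_sum_finite_sum S has_sum_infsum AB)
    have "(\<Sum>k\<in>S. (?w k * cmod (?c k))\<^sup>2) \<le> (\<Sum>k\<in>S. M * (\<Sum>\<^sub>\<infinity>j. A j * B (k - j)))"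
      by (intro sum_mono c_le)
    also have "\<dots> = M * (\<Sum>\<^sub>\<infinity>j. \<Sum>k\<in>S. A j * B (k - j))"
      by (simp add: sum_distrib_left infsumI[OF sum_S])
    also have "(\<Sum>\<^sub>\<infinity>j. \<Sum>k\<in>S. A j * B (k - j)) \<le> (\<Sum>\<^sub>\<infinity>j. A j * infsum B UNIV)"
    proof (rule infsum_mono)
      show "(\<lambda>j. \<Sum>k\<in>S. A j * B (k - j)) summable_on UNIV"
        using sum_S by (rule has_sum_imp_summable)
      show "(\<lambda>j. A j * infsum B UNIV) summable_on UNIV" by (intro summable_on_cmult_left A)
      show "(\<Sum>k\<in>S. A j * B (k - j)) \<le> A j * infsum B UNIV" for j
        unfolding sum_distrib_left[symmetric] by (intro mult_left_mono B_le S A)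
    qed
    also have "(\<Sum>\<^sub>\<infinity>j. A j * infsum B UNIV) = infsum A UNIV * infsum B UNIV"
      by (rule infsum_cmult_left')
    finally have "(\<Sum>k\<in>S. (?w k * cmod (?c k))\<^sup>2) \<le> M * ((seq_norm s a)\<^sup>2 * (seq_norm s b)\<^sup>2)"
      by (simp add: norm_sq M_def mult_left_mono)
    also have "\<dots> = (algebra_const s * seq_norm s a * seq_norm s b)\<^sup>2"
      by (simp add: algebra_const_def M_def power_mult_distrib)
    finally show ?thesis
      unfolding L2_set_def
      by (intro real_le_lsqrt) (auto intro!: mult_nonneg_nonneg algebra_const_nonneg seq_norm_nonneg sum_nonneg)
  qed
  then show "?c \<in> seq_space s" "seq_norm s ?c \<le> algebra_const s * seq_norm s a * seq_norm s b"
    by (auto intro: seq_spaceI)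
qed

section \<open>The Sobolev space as a complete metric space\<close>

lemma sobolev_norm_seq_norm: "sobolev_norm s u = seq_norm s (fourier_coeff u)"
  by (simp add: sobolev_norm_def seq_norm_def power_mult_distrib weight_sq mult.assoc infsum_cmult_right')

lemma sobolev_space_iff: "u \<in> sobolev_space s \<longleftrightarrow> real_valued u \<and> fourier_coeff u \<in> seq_space s"
  by (simp add: sobolev_space_def seq_space_def power_mult_distrib weight_sq mult.assoc summable_on_cmult_right')

lemma sobolev_norm_nonneg: "0 \<le> sobolev_norm s u"
  by (simp add: sobolev_norm_seq_norm seq_norm_nonneg)

lemma sobolev_space_add: "u \<in> sobolev_space s \<Longrightarrow> v \<in> sobolev_space s \<Longrightarrow> u + v \<in> sobolev_space s"
  using seq_space_add(1)[of "fourier_coeff u" s "fourier_coeff v"]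
  by (simp add: sobolev_space_iff real_valued_add fourier_coeff_add[abs_def])

lemma sobolev_norm_add:
  "u \<in> sobolev_space s \<Longrightarrow> v \<in> sobolev_space s \<Longrightarrow> sobolev_norm s (u + v) \<le> sobolev_norm s u + sobolev_norm s v"
  using seq_space_add(2)[of "fourier_coeff u" s "fourier_coeff v"]
  by (simp add: sobolev_space_iff sobolev_norm_seq_norm fourier_coeff_add[abs_def])

lemma sobolev_space_diff: "u \<in> sobolev_space s \<Longrightarrow> v \<in> sobolev_space s \<Longrightarrow> u - v \<in> sobolev_space s"
  using seq_space_diff[of "fourier_coeff u" s "fourier_coeff v"]
  by (simp add: sobolev_space_iff real_valued_diff fourier_coeff_diff[abs_def])

lemma sobolev_space_scaleR: "u \<in> sobolev_space s \<Longrightarrow> c *\<^sub>R u \<in> sobolev_space s"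
  using seq_space_cmult(1)[of "fourier_coeff u" s "of_real c"]
  by (simp add: sobolev_space_iff real_valued_scaleR fourier_coeff_scaleR[abs_def] scaleR_conv_of_real)

lemma sobolev_norm_commute: "sobolev_norm s (u - v) = sobolev_norm s (v - u)"
  by (simp add: sobolev_norm_def fourier_coeff_diff norm_minus_commute)

lemma sobolev_norm_triangle:
  "u \<in> sobolev_space s \<Longrightarrow> v \<in> sobolev_space s \<Longrightarrow> w \<in> sobolev_space s \<Longrightarrow>
    sobolev_norm s (u - w) \<le> sobolev_norm s (u - v) + sobolev_norm s (v - w)"
  using sobolev_norm_add[of "u - v" s "v - w"] by (simp add: sobolev_space_diff)

lemma sobolev_space_0: "0 \<in> sobolev_space s"
  by (simp add: sobolev_space_iff real_valued_0 seq_space_def fourier_coeff_0)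

lemma sobolev_norm_0: "sobolev_norm s 0 = 0"
  by (simp add: sobolev_norm_def fourier_coeff_0)

lemma sobolev_norm_eq_0:
  assumes "u \<in> sobolev_space s" "sobolev_norm s u = 0"
  shows "u = 0"
proof (rule per_dist_eqI)
  fix k
  have "weight s k * cmod (fourier_coeff u k) \<le> 0"
    using coeff_le_seq_norm[of "fourier_coeff u" s k] assms by (simp add: sobolev_norm_seq_norm sobolev_space_iff)
  then show "fourier_coeff u k = fourier_coeff 0 k"
    using weight_pos[of s k] by (simp add: fourier_coeff_0 mult_le_0_iff)
qed

interpretation sobolev: Metric_space "sobolev_space s" "\<lambda>u v. sobolev_norm s (u - v)" for s
proof
  show "sobolev_norm s (u - v) = 0 \<longleftrightarrow> u = v" if "u \<in> sobolev_space s" "v \<in> sobolev_space s" for u v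
    using sobolev_norm_eq_0[OF sobolev_space_diff[OF that]] by (auto simp: sobolev_norm_0)
qed (auto simp: sobolev_norm_nonneg sobolev_norm_commute sobolev_norm_triangle)

lemma mspace_sobolev_metric [simp]: "mspace (sobolev_metric s) = sobolev_space s"
  by (simp add: sobolev_metric_def)

lemma mdist_sobolev_metric [simp]: "mdist (sobolev_metric s) = (\<lambda>u v. sobolev_norm s (u - v))"
  by (simp add: sobolev_metric_def)

lemma sobolev_abs_summable:
  assumes "s > 1 / 2" "u \<in> sobolev_space s"
  shows "(\<lambda>k. cmod (fourier_coeff u k)) summable_on UNIV"
    "(\<Sum>\<^sub>\<infinity>k. cmod (fourier_coeff u k)) \<le> embed_const s * sobolev_norm s u"
  using seq_space_abs_summable[OF assms(1)] assms(2) by (simp_all add: sobolev_space_iff sobolev_norm_seq_norm)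

lemma sobolev_space_exists:
  assumes "s > 1 / 2" "a \<in> seq_space s" "\<And>k. a (- k) = cnj (a k)"
  obtains u where "u \<in> sobolev_space s" "fourier_coeff u = a"
proof -
  have summ: "(\<lambda>k. cmod (a k)) summable_on UNIV" by (rule seq_space_abs_summable[OF assms(1,2)])
  have eq: "fourier_coeff (dist_of (synth a)) = a" using fourier_coeff_synth[OF summ] by auto
  have "real_valued (dist_of (synth a))" by (rule real_valuedI) (auto simp: eq summ assms(3))
  then show ?thesis using that eq assms(2) by (auto simp: sobolev_space_iff)
qed

text \<open>Each coefficient converges because a single one is bounded by the norm over its weight.
  The limit sequence has to be shown square summable and Hermitian before it is synthesised into a
  real distribution.\<close>

lemma sobolev_mcomplete:
  assumes s: "s > 1 / 2"
  shows "sobolev.mcomplete s"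
  unfolding sobolev.mcomplete_def
proof (intro allI impI)
  fix \<sigma> assume "sobolev.MCauchy s \<sigma>"
  then have in_space: "\<sigma> n \<in> sobolev_space s" 
    and Cauchy: "\<And>e. e > 0 \<Longrightarrow> \<exists>N. \<forall>n m. N \<le> n \<longrightarrow> N \<le> m \<longrightarrow> sobolev_norm s (\<sigma> n - \<sigma> m) < e" for n
    by (auto simp: sobolev.MCauchy_def)
  have L2: "L2_set (\<lambda>k. weight s k * cmod (fourier_coeff (\<sigma> m) k - fourier_coeff (\<sigma> n) k)) S \<le> sobolev_norm s (\<sigma> m - \<sigma> n)" for m n S
    using L2_set_le_seq_norm[of "fourier_coeff (\<sigma> m - \<sigma> n)" s S] sobolev_space_diff[OF in_space in_space, of m n]
    by (simp add: sobolev_space_iff sobolev_norm_seq_norm fourier_coeff_diff)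
  have "convergent (\<lambda>n. fourier_coeff (\<sigma> n) k)" for k
  proof (rule Cauchy_convergent, rule metric_CauchyI)
    fix e :: real assume e: "e > 0"
    obtain N where N: "\<And>n m. N \<le> n \<Longrightarrow> N \<le> m \<Longrightarrow> sobolev_norm s (\<sigma> n - \<sigma> m) < weight s k * e"
      using Cauchy[of "weight s k * e"] e weight_pos[of s k] by (meson mult_pos_pos)
    have "dist (fourier_coeff (\<sigma> m) k) (fourier_coeff (\<sigma> n) k) < e" if "N \<le> m" "N \<le> n" for m n
    proof -
      have "weight s k * cmod (fourier_coeff (\<sigma> m) k - fourier_coeff (\<sigma> n) k) < weight s k * e"
        using order_le_less_trans[OF L2[of m n "{k}"] N[OF that]] weight_pos[of s k] by simp
      then show ?thesis using weight_pos[of s k] by (simp add: dist_norm)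
    qed
    then show "\<exists>M. \<forall>m\<ge>M. \<forall>n\<ge>M. dist (fourier_coeff (\<sigma> m) k) (fourier_coeff (\<sigma> n) k) < e" by blast
  qed
  then obtain a where a: "\<And>k. (\<lambda>n. fourier_coeff (\<sigma> n) k) \<longlonglongrightarrow> a k"
    unfolding convergent_def by metis
  \<comment> \<open>A Fatou argument on sections: for fixed \<open>S\<close> the section norm is
    continuous in the coefficients, so the Cauchy bound survives m to infinity.\<close>
  have close: "L2_set (\<lambda>k. weight s k * cmod (a k - fourier_coeff (\<sigma> n) k)) S \<le> e"
    if "\<And>m. N \<le> m \<Longrightarrow> sobolev_norm s (\<sigma> m - \<sigma> n) < e" for S n N e
  proof (rule LIMSEQ_le_const2)
    show "(\<lambda>m. L2_set (\<lambda>k. weight s k * cmod (fourier_coeff (\<sigma> m) k - fourier_coeff (\<sigma> n) k)) S)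
      \<longlonglongrightarrow> L2_set (\<lambda>k. weight s k * cmod (a k - fourier_coeff (\<sigma> n) k)) S"
      unfolding L2_set_def by (intro tendsto_intros a)
    show "\<exists>N. \<forall>m\<ge>N. L2_set (\<lambda>k. weight s k * cmod (fourier_coeff (\<sigma> m) k - fourier_coeff (\<sigma> n) k)) S \<le> e"
      using that L2 by (meson less_imp_le order_trans)
  qed
  obtain N where N: "\<And>n m. N \<le> n \<Longrightarrow> N \<le> m \<Longrightarrow> sobolev_norm s (\<sigma> n - \<sigma> m) < 1"
    using Cauchy[of 1] by auto
  \<comment> \<open>The limit lies at finite distance from one term of the sequence, hence in the
    space itself.\<close>
  have "(\<lambda>k. a k - fourier_coeff (\<sigma> N) k) \<in> seq_space s"
    by (rule seq_spaceI(1)[OF close[of N]]) (auto intro: N)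
  then have "(\<lambda>k. (a k - fourier_coeff (\<sigma> N) k) + fourier_coeff (\<sigma> N) k) \<in> seq_space s"
    using in_space by (intro seq_space_add) (auto simp: sobolev_space_iff)
  then have "a \<in> seq_space s" by simp
  moreover have "a (- k) = cnj (a k)" for k
  proof (rule LIMSEQ_unique[OF a])
    have "fourier_coeff (\<sigma> n) (- k) = cnj (fourier_coeff (\<sigma> n) k)" for n
      using in_space by (intro real_valued_fourier_coeff) (auto simp: sobolev_space_iff)
    then show "(\<lambda>n. fourier_coeff (\<sigma> n) (- k)) \<longlonglongrightarrow> cnj (a k)"
      using tendsto_cnj[OF a] by simp
  qed
  ultimately obtain u where u: "u \<in> sobolev_space s" "fourier_coeff u = a"
    using sobolev_space_exists[OF s] by blast
  have "limitin (sobolev.mtopology s) \<sigma> u sequentially"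
    unfolding sobolev.limit_metric_sequentially
  proof (intro conjI allI impI u)
    fix e :: real assume "e > 0"
    then obtain N where N: "\<And>n m. N \<le> n \<Longrightarrow> N \<le> m \<Longrightarrow> sobolev_norm s (\<sigma> n - \<sigma> m) < e / 2"
      using Cauchy[of "e / 2"] by auto
    have "sobolev_norm s (\<sigma> n - u) \<le> e / 2" if "n \<ge> N" for n
    proof -
      have "seq_norm s (\<lambda>k. a k - fourier_coeff (\<sigma> n) k) \<le> e / 2"
        using N[OF _ that] by (intro seq_spaceI(2)[OF close[of N]]) auto
      then show ?thesis
        by (subst sobolev_norm_commute) (simp add: sobolev_norm_seq_norm fourier_coeff_diff[abs_def] u(2))
    qed
    then show "\<exists>N. \<forall>n\<ge>N. \<sigma> n \<in> sobolev_space s \<and> sobolev_norm s (\<sigma> n - u) < e"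
      using in_space \<open>e > 0\<close> by (intro exI[of _ N]) force
  qed
  then show "\<exists>x. limitin (sobolev.mtopology s) \<sigma> x sequentially" by blast
qed

section \<open>The nonlinearity\<close>

definition nonlin :: "per_dist \<Rightarrow> per_dist" where
  "nonlin u = K_op (u + (1 / 2) *\<^sub>R dist_square u)"

lemma dist_square_sobolev:
  assumes s: "s > 1 / 2" and u: "u \<in> sobolev_space s"
  shows "dist_square u \<in> sobolev_space s"
    "fourier_coeff (dist_square u) = (\<lambda>k. \<Sum>\<^sub>\<infinity>j. fourier_coeff u j * fourier_coeff u (k - j))"
proof -
  let ?a = "fourier_coeff u"
  have a: "?a \<in> seq_space s" "real_valued u" using u by (simp_all add: sobolev_space_iff)
  show coeff: "fourier_coeff (dist_square u) = (\<lambda>k. \<Sum>\<^sub>\<infinity>j. ?a j * ?a (k - j))"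
    by (rule ext, rule infsumI[symmetric], rule fourier_coeff_dist_square[OF sobolev_abs_summable(1)[OF s u]])
  have mem: "fourier_coeff (dist_square u) \<in> seq_space s"
    unfolding coeff by (rule convolution_seq_space[OF s a(1) a(1)])
  have "fourier_coeff (dist_square u) (- k) = cnj (fourier_coeff (dist_square u) k)" for k
  proof -
    have "cnj (\<Sum>\<^sub>\<infinity>j. ?a j * ?a (k - j)) = (\<Sum>\<^sub>\<infinity>j. cnj (?a j * ?a (k - j)))"
      by (rule infsum_cnj[symmetric])
    also have "\<dots> = (\<Sum>\<^sub>\<infinity>j. ?a (- j) * ?a (- k - (- j)))"
      using real_valued_fourier_coeff[OF a(2)] by (auto simp: real_valued_fourier_coeff[OF a(2), symmetric])
    also have "\<dots> = (\<Sum>\<^sub>\<infinity>j. ?a j * ?a (- k - j))"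
      by (rule infsum_reindex_bij_witness[of _ uminus uminus]) auto
    finally show ?thesis by (simp add: coeff)
  qed
  then show "dist_square u \<in> sobolev_space s"
    using mem seq_space_abs_summable(1)[OF s mem] by (auto simp: sobolev_space_iff intro: real_valuedI)
qed

lemma norm_K_symbol_le: "cmod (- \<i> * of_int k / (1 + of_int \<bar>k\<bar>)) \<le> 1"
proof -
  have "cmod (1 + complex_of_int \<bar>k\<bar>) = 1 + real_of_int \<bar>k\<bar>"
    using norm_of_int[of "1 + \<bar>k\<bar>", where 'a = complex] by simp
  then show ?thesis by (simp add: norm_divide norm_mult)
qed

lemma K_op_sobolev:
  assumes s: "s > 1 / 2" and v: "v \<in> sobolev_space s"
  shows "K_op v \<in> sobolev_space s"
    "fourier_coeff (K_op v) k = - \<i> * of_int k / (1 + of_int \<bar>k\<bar>) * fourier_coeff v k"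
proof -
  let ?m = "\<lambda>n. - \<i> * complex_of_int n / (1 + complex_of_int \<bar>n\<bar>)"
  have le: "cmod (?m k * fourier_coeff v k) \<le> cmod (fourier_coeff v k)" for k
    unfolding norm_mult[of _ "fourier_coeff v k"] by (intro mult_left_le_one_le norm_K_symbol_le) auto
  have "(\<lambda>k. ?m k * fourier_coeff v k) \<in> seq_space s"
    using v by (intro seq_space_mono(1)[OF _ le]) (simp add: sobolev_space_iff)
  note mem = this seq_space_abs_summable(1)[OF s this]
  show coeff: "fourier_coeff (K_op v) k = ?m k * fourier_coeff v k" for k
    unfolding K_op_def by (rule fourier_coeff_multiplier[OF mem(2)])
  have "fourier_coeff (K_op v) (- k) = cnj (fourier_coeff (K_op v) k)" for k
    using v real_valued_fourier_coeff[of v k] by (simp add: coeff sobolev_space_iff)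
  then show "K_op v \<in> sobolev_space s"
    using mem by (auto simp: sobolev_space_iff coeff[abs_def] intro!: real_valuedI)
qed

lemma nonlin_sobolev:
  assumes s: "s > 1 / 2" and u: "u \<in> sobolev_space s"
  shows "nonlin u \<in> sobolev_space s"
  unfolding nonlin_def by (intro K_op_sobolev sobolev_space_add sobolev_space_scaleR dist_square_sobolev s u)

text \<open>With d = u - v, the difference of squares is written as d u + v d. Each product costs
  \<open>algebra_const s * R\<close> times the norm of d; the factor 1/2 of the nonlinearity cancels
  the number of products, and K does not increase any coefficient.\<close>

lemma nonlin_Lipschitz:
  assumes s: "s > 1 / 2" and u: "u \<in> sobolev_space s" and v: "v \<in> sobolev_space s"
    and R: "sobolev_norm s u \<le> R" "sobolev_norm s v \<le> R"
  shows "sobolev_norm s (nonlin u - nonlin v) \<le> (1 + algebra_const s * R) * sobolev_norm s (u - v)"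
proof -
  let ?a = "fourier_coeff u" and ?b = "fourier_coeff v" and ?C = "algebra_const s"
  define d where "d = (\<lambda>k. ?a k - ?b k)"
  have a: "?a \<in> seq_space s" and b: "?b \<in> seq_space s" using u v by (simp_all add: sobolev_space_iff)
  have d: "d \<in> seq_space s" unfolding d_def by (rule seq_space_diff[OF a b])
  have d_norm: "seq_norm s d = sobolev_norm s (u - v)"
    by (simp add: d_def sobolev_norm_seq_norm fourier_coeff_diff[abs_def])
  let ?p = "\<lambda>k. \<Sum>\<^sub>\<infinity>j. d j * ?a (k - j)" and ?q = "\<lambda>k. \<Sum>\<^sub>\<infinity>j. ?b j * d (k - j)"
  let ?h = "\<lambda>k. d k + 1 / 2 * (?p k + ?q k)"
  note p = convolution_seq_space[OF s d a] and q = convolution_seq_space[OF s b d]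
  have sq: "fourier_coeff (dist_square u) k - fourier_coeff (dist_square v) k = ?p k + ?q k" for k
  proof -
    have "(\<lambda>j. ?a j * ?a (k - j)) = (\<lambda>j. ?b j * ?b (k - j) + (d j * ?a (k - j) + ?b j * d (k - j)))"
      by (simp add: d_def algebra_simps)
    then have "(\<Sum>\<^sub>\<infinity>j. ?a j * ?a (k - j)) = (\<Sum>\<^sub>\<infinity>j. ?b j * ?b (k - j)) + (?p k + ?q k)"
      by (simp add: infsum_add summable_on_add p(1) q(1) convolution_seq_space(1)[OF s b b])
    then show ?thesis
      unfolding dist_square_sobolev(2)[OF s u] dist_square_sobolev(2)[OF s v] by simp
  qed
  have half: "(1 / 2) *\<^sub>R dist_square x \<in> sobolev_space s" if "x \<in> sobolev_space s" for x
    by (intro sobolev_space_scaleR dist_square_sobolev s that)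
  have coeff: "fourier_coeff (nonlin u - nonlin v) k = - \<i> * of_int k / (1 + of_int \<bar>k\<bar>) * ?h k" for k
    unfolding nonlin_def fourier_coeff_diff
      K_op_sobolev(2)[OF s sobolev_space_add[OF u half[OF u]]] K_op_sobolev(2)[OF s sobolev_space_add[OF v half[OF v]]]
    unfolding fourier_coeff_add fourier_coeff_scaleR sq[symmetric] right_diff_distrib[symmetric]
    by (simp add: d_def scaleR_conv_of_real algebra_simps add_divide_distrib)
  have "cmod (fourier_coeff (nonlin u - nonlin v) k) \<le> cmod (?h k)" for k
    unfolding coeff norm_mult[of _ "?h k"] by (intro mult_left_le_one_le norm_K_symbol_le) auto
  moreover have pq: "(\<lambda>k. ?p k + ?q k) \<in> seq_space s" "seq_norm s (\<lambda>k. ?p k + ?q k) \<le> seq_norm s ?p + seq_norm s ?q"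
    by (intro seq_space_add p q)+
  moreover have "?h \<in> seq_space s" by (intro seq_space_add seq_space_cmult d pq)
  ultimately have "sobolev_norm s (nonlin u - nonlin v) \<le> seq_norm s ?h"
    unfolding sobolev_norm_seq_norm by (intro seq_space_mono(2))
  also have "\<dots> \<le> seq_norm s d + seq_norm s (\<lambda>k. 1 / 2 * (?p k + ?q k))"
    by (intro seq_space_add seq_space_cmult d pq)
  also have "seq_norm s (\<lambda>k. 1 / 2 * (?p k + ?q k)) \<le> 1 / 2 * (seq_norm s ?p + seq_norm s ?q)"
    using seq_space_cmult(2)[OF pq(1), of "1 / 2"] pq(2) by simp
  also have "seq_norm s ?p \<le> ?C * seq_norm s d * R"
    using R(1) by (intro order_trans[OF p(3)] mult_left_mono)
      (auto simp: sobolev_norm_seq_norm intro!: mult_nonneg_nonneg algebra_const_nonneg seq_norm_nonneg)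
  also have "seq_norm s ?q \<le> ?C * R * seq_norm s d"
    using R(2) by (intro order_trans[OF q(3)] mult_left_mono mult_right_mono)
      (auto simp: sobolev_norm_seq_norm intro!: algebra_const_nonneg seq_norm_nonneg)
  finally show ?thesis unfolding d_norm by (simp add: algebra_simps)
qed

text \<open>Turns the Lipschitz estimate into a bound on \<open>nonlin u\<close> itself. No exponent
  occurs in the statement; s = 1 is an admissible choice for the coefficient formulas.\<close>

lemma nonlin_0: "nonlin 0 = 0"
proof -
  have "dist_square 0 = 0"
    using dist_square_sobolev(2)[OF _ sobolev_space_0, of 1] by (intro per_dist_eqI) (simp add: fourier_coeff_0)
  then show ?thesis
    using K_op_sobolev(2)[OF _ sobolev_space_0, of 1] unfolding nonlin_def
    by (intro per_dist_eqI) (simp add: fourier_coeff_0)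
qed

section \<open>Curves in the Sobolev space and their integrals\<close>

text \<open>Norm continuity spelled out, since \<open>per_dist\<close> carries only a vector space
  structure. \<open>continuous_map_iff_curve\<close> identifies it with continuity into
  \<open>sobolev_metric s\<close>.\<close>

definition curve :: "real \<Rightarrow> real set \<Rightarrow> (real \<Rightarrow> per_dist) \<Rightarrow> bool" where
  "curve s I F \<longleftrightarrow> (\<forall>t\<in>I. F t \<in> sobolev_space s) \<and>
     (\<forall>t\<in>I. \<forall>e>0. \<exists>d>0. \<forall>\<tau>\<in>I. dist \<tau> t < d \<longrightarrow> sobolev_norm s (F \<tau> - F t) < e)"

lemma curveD: "curve s I F \<Longrightarrow> t \<in> I \<Longrightarrow> F t \<in> sobolev_space s"
  by (simp add: curve_def)

lemma fourier_coeff_uminus: "fourier_coeff (- u) k = - fourier_coeff u k"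
  using fourier_coeff_diff[of 0 u k] by (simp add: fourier_coeff_0)

lemma sobolev_norm_uminus: "sobolev_norm s (- u) = sobolev_norm s u"
  by (simp add: sobolev_norm_def fourier_coeff_uminus)

lemma sobolev_space_uminus: "u \<in> sobolev_space s \<Longrightarrow> - u \<in> sobolev_space s"
  using sobolev_space_diff[OF sobolev_space_0] by fastforce

lemma curve_subset: "curve s I F \<Longrightarrow> J \<subseteq> I \<Longrightarrow> curve s J F"
  unfolding curve_def by (meson subsetD)

lemma curve_close:
  assumes "curve s I F" "t \<in> I" "e > 0"
  obtains d where "d > 0" "\<And>\<tau>. \<tau> \<in> I \<Longrightarrow> dist \<tau> t < d \<Longrightarrow> sobolev_norm s (F \<tau> - F t) < e"
proof -
  have "\<exists>d>0. \<forall>\<tau>\<in>I. dist \<tau> t < d \<longrightarrow> sobolev_norm s (F \<tau> - F t) < e"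
    using assms unfolding curve_def by simp
  then show ?thesis using that by auto
qed

lemma curve_cong: "(\<And>t. t \<in> I \<Longrightarrow> F t = G t) \<Longrightarrow> curve s I F \<longleftrightarrow> curve s I G"
  unfolding curve_def by simp

lemma continuous_map_iff_curve:
  "continuous_map (top_of_set I) (mtopology_of (sobolev_metric s)) F \<longleftrightarrow> curve s I F"
proof -
  have "continuous_map (top_of_set I) (mtopology_of (sobolev_metric s)) F \<longleftrightarrow>
    (\<forall>t\<in>I. \<forall>e>0. \<exists>U. openin (top_of_set I) U \<and> t \<in> U \<and> (\<forall>\<tau>\<in>U. F \<tau> \<in> sobolev.mball s (F t) e))"
    unfolding sobolev_metric_def sobolev.mtopology_of sobolev.continuous_map_to_metric by simp
  also have "\<dots> \<longleftrightarrow> curve s I F"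
  proof
    assume L: "\<forall>t\<in>I. \<forall>e>0. \<exists>U. openin (top_of_set I) U \<and> t \<in> U \<and> (\<forall>\<tau>\<in>U. F \<tau> \<in> sobolev.mball s (F t) e)"
    have "F t \<in> sobolev_space s" if "t \<in> I" for t
      using L[rule_format, OF that zero_less_one] by (metis sobolev.in_mball)
    moreover have "\<exists>d>0. \<forall>\<tau>\<in>I. dist \<tau> t < d \<longrightarrow> sobolev_norm s (F \<tau> - F t) < e" if "t \<in> I" "e > 0" for t e
    proof -
      from L[rule_format, OF that] obtain U
        where U: "openin (top_of_set I) U" "t \<in> U" "\<forall>\<tau>\<in>U. F \<tau> \<in> sobolev.mball s (F t) e"
        by (elim exE conjE)
      then obtain d where d: "d > 0" "ball t d \<inter> I \<subseteq> U" by (meson openin_contains_ball)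
      have "sobolev_norm s (F \<tau> - F t) < e" if "\<tau> \<in> I" "dist \<tau> t < d" for \<tau>
      proof -
        have "\<tau> \<in> U" using d(2) that by (auto simp: dist_commute)
        then show ?thesis using U(3) by (subst sobolev_norm_commute) auto
      qed
      then show ?thesis using d by blast
    qed
    ultimately show "curve s I F" unfolding curve_def by blast
  next
    assume C: "curve s I F"
    show "\<forall>t\<in>I. \<forall>e>0. \<exists>U. openin (top_of_set I) U \<and> t \<in> U \<and> (\<forall>\<tau>\<in>U. F \<tau> \<in> sobolev.mball s (F t) e)"
    proof (intro ballI allI impI)
      fix t e :: real assume te: "t \<in> I" "e > 0"
      then obtain d where d: "d > 0" "\<And>\<tau>. \<tau> \<in> I \<Longrightarrow> dist \<tau> t < d \<Longrightarrow> sobolev_norm s (F \<tau> - F t) < e"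
        using curve_close[OF C] by blast
      have "\<forall>\<tau>\<in>I \<inter> ball t d. F \<tau> \<in> sobolev.mball s (F t) e"
        using d te curveD[OF C] by (auto simp: dist_commute sobolev_norm_commute[of s "F t"])
      then show "\<exists>U. openin (top_of_set I) U \<and> t \<in> U \<and> (\<forall>\<tau>\<in>U. F \<tau> \<in> sobolev.mball s (F t) e)"
        using d te by (intro exI[of _ "I \<inter> ball t d"]) (auto intro: openin_open_Int)
    qed
  qed
  finally show ?thesis .
qed

lemma sobolev_norm_triangle_abs:
  assumes "u \<in> sobolev_space s" "v \<in> sobolev_space s"
  shows "\<bar>sobolev_norm s u - sobolev_norm s v\<bar> \<le> sobolev_norm s (u - v)"
  using sobolev_norm_add[of "u - v" s v] sobolev_norm_add[of "v - u" s u] assms sobolev_norm_commute[of s u v]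
  by (simp add: sobolev_space_diff)

lemma curve_norm_continuous:
  assumes "curve s I F"
  shows "continuous_on I (\<lambda>t. sobolev_norm s (F t))"
  unfolding continuous_on_iff
proof (intro ballI allI impI)
  fix t e :: real assume te: "t \<in> I" "e > 0"
  then obtain d where d: "d > 0" "\<And>\<tau>. \<tau> \<in> I \<Longrightarrow> dist \<tau> t < d \<Longrightarrow> sobolev_norm s (F \<tau> - F t) < e"
    using curve_close[OF assms] by blast
  have "dist (sobolev_norm s (F \<tau>)) (sobolev_norm s (F t)) < e" if "\<tau> \<in> I" "dist \<tau> t < d" for \<tau>
    unfolding dist_real_def
    by (rule order_le_less_trans[OF sobolev_norm_triangle_abs[OF curveD[OF assms that(1)] curveD[OF assms te(1)]] d(2)[OF that]])
  then show "\<exists>d>0. \<forall>\<tau>\<in>I. dist \<tau> t < d \<longrightarrow> dist (sobolev_norm s (F \<tau>)) (sobolev_norm s (F t)) < e"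
    using d(1) by auto
qed

lemma curve_bounded:
  assumes "curve s {p..q} F"
  obtains R where "R \<ge> 0" "\<And>t. t \<in> {p..q} \<Longrightarrow> sobolev_norm s (F t) \<le> R"
  using continuous_interval_bounded[OF curve_norm_continuous[OF assms]] by (auto simp: sobolev_norm_nonneg)

lemma curveI_le:
  assumes F: "curve s I F" and "\<And>t. t \<in> I \<Longrightarrow> G t \<in> sobolev_space s"
    and le: "\<And>t \<tau>. t \<in> I \<Longrightarrow> \<tau> \<in> I \<Longrightarrow> sobolev_norm s (G \<tau> - G t) \<le> L * sobolev_norm s (F \<tau> - F t)"
  shows "curve s I G"
  unfolding curve_def
proof (intro conjI ballI allI impI assms(2))
  fix t e :: real assume te: "t \<in> I" "e > 0"
  \<comment> \<open>\<open>L\<close> may be zero or negative, so \<open>\<bar>L\<bar> + 1\<close>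
    replaces it as a positive divisor.\<close>
  then have "e / (\<bar>L\<bar> + 1) > 0" by simp
  with te(1) obtain d where d: "d > 0" "\<And>\<tau>. \<tau> \<in> I \<Longrightarrow> dist \<tau> t < d \<Longrightarrow> sobolev_norm s (F \<tau> - F t) < e / (\<bar>L\<bar> + 1)"
    using curve_close[OF F] by blast
  have "sobolev_norm s (G \<tau> - G t) < e" if "\<tau> \<in> I" "dist \<tau> t < d" for \<tau>
  proof -
    have "sobolev_norm s (G \<tau> - G t) \<le> (\<bar>L\<bar> + 1) * sobolev_norm s (F \<tau> - F t)"
      using abs_ge_self[of L]
      by (intro order_trans[OF le[OF te(1) that(1)]] mult_right_mono sobolev_norm_nonneg) linarith
    also have "\<dots> < e" using d(2)[OF that] by (simp add: pos_less_divide_eq mult.commute)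
    finally show ?thesis .
  qed
  then show "\<exists>d>0. \<forall>\<tau>\<in>I. dist \<tau> t < d \<longrightarrow> sobolev_norm s (G \<tau> - G t) < e" using d(1) by auto
qed

lemma curve_diff:
  assumes "curve s I F" "curve s I G"
  shows "curve s I (\<lambda>t. F t - G t)"
  unfolding curve_def
proof (intro conjI ballI allI impI)
  fix t e :: real assume te: "t \<in> I" "e > 0"
  then have "e / 2 > 0" by simp
  from te(1) this obtain c where c: "c > 0" "\<And>\<tau>. \<tau> \<in> I \<Longrightarrow> dist \<tau> t < c \<Longrightarrow> sobolev_norm s (F \<tau> - F t) < e / 2"
    using curve_close[OF assms(1)] by blast
  from te(1) \<open>e / 2 > 0\<close> obtain d where d: "d > 0" "\<And>\<tau>. \<tau> \<in> I \<Longrightarrow> dist \<tau> t < d \<Longrightarrow> sobolev_norm s (G \<tau> - G t) < e / 2"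
    using curve_close[OF assms(2)] by blast
  have "sobolev_norm s (F \<tau> - G \<tau> - (F t - G t)) < e" if "\<tau> \<in> I" "dist \<tau> t < min c d" for \<tau>
  proof -
    have "F \<tau> - G \<tau> - (F t - G t) = (F \<tau> - F t) + (G t - G \<tau>)" by simp
    then have "sobolev_norm s (F \<tau> - G \<tau> - (F t - G t)) \<le> sobolev_norm s (F \<tau> - F t) + sobolev_norm s (G t - G \<tau>)"
      using te that assms by (simp only:) (intro sobolev_norm_add sobolev_space_diff curveD)
    then show ?thesis
      using c(2)[of \<tau>] d(2)[of \<tau>] that by (simp add: sobolev_norm_commute[of s "G t"])
  qed
  then show "\<exists>d>0. \<forall>\<tau>\<in>I. dist \<tau> t < d \<longrightarrow> sobolev_norm s (F \<tau> - G \<tau> - (F t - G t)) < e"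
    using c d by (intro exI[of _ "min c d"]) auto
qed (use assms in \<open>auto intro: sobolev_space_diff curveD\<close>)

text \<open>On a compact interval the curve stays in some ball, and on a ball the nonlinearity is
  Lipschitz.\<close>

lemma curve_nonlin:
  assumes s: "s > 1 / 2" and F: "curve s {p..q} F"
  shows "curve s {p..q} (\<lambda>t. nonlin (F t))"
proof -
  obtain R where R: "\<And>t. t \<in> {p..q} \<Longrightarrow> sobolev_norm s (F t) \<le> R" using curve_bounded[OF F] by blast
  show ?thesis
    by (rule curveI_le[OF F nonlin_sobolev[OF s curveD[OF F]] nonlin_Lipschitz[OF s curveD[OF F] curveD[OF F] R R]])
qed

lemma pairing_sobolev_bound:
  assumes s: "s > 1 / 2" and "u \<in> sobolev_space s" "\<phi> \<in> test_functions" "\<And>x. cmod (\<phi> x) \<le> B"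
  shows "cmod (pairing u \<phi>) \<le> 2 * pi * embed_const s * B * sobolev_norm s u"
proof -
  have B: "0 \<le> B" using norm_ge_zero order_trans assms(4)[of 0] by blast
  have "cmod (pairing u \<phi>) \<le> 2 * pi * ((\<Sum>\<^sub>\<infinity>k. cmod (fourier_coeff u k)) * B)"
    by (intro pairing_summable_bound sobolev_abs_summable[OF s] assms)
  also have "\<dots> \<le> 2 * pi * (embed_const s * sobolev_norm s u * B)"
    using B by (intro mult_left_mono mult_right_mono sobolev_abs_summable[OF s] assms) auto
  finally show ?thesis by (simp add: mult_ac)
qed

lemma test_functions_bounded:
  assumes "\<phi> \<in> test_functions"
  obtains B where "\<And>x. cmod (\<phi> x) \<le> B"
proof -
  obtain B where B: "\<And>x. x \<in> {- pi..pi} \<Longrightarrow> cmod (\<phi> x) \<le> B"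
    using continuous_interval_bounded[OF test_functions_continuous[OF assms]] by blast
  have "\<phi> x = \<phi> (Arg (cis x))" for x
    by (rule periodic_cis_cong[of \<phi>, OF test_functions_periodic[OF assms]]) (auto simp: cis_Arg sgn_div_norm)
  then have "cmod (\<phi> x) \<le> B" for x
    using B[of "Arg (cis x)"] Arg_bounded[of "cis x"] by simp
  then show ?thesis using that by blast
qed

lemma pairing_minus: "pairing (u - v) \<phi> = pairing u \<phi> - pairing v \<phi>"
proof -
  have "pairing u \<phi> = pairing ((u - v) + v) \<phi>" by simp
  also have "\<dots> = pairing (u - v) \<phi> + pairing v \<phi>" by (simp only: plus_per_dist.rep_eq)
  finally show ?thesis by simp
qed

text \<open>Norm continuity implies weak continuity; this makes the scalar integrals that define
  \<open>dist_integral\<close> exist.\<close>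

lemma curve_pairing_continuous:
  assumes s: "s > 1 / 2" and F: "curve s I F" and \<phi>: "\<phi> \<in> test_functions"
  shows "continuous_on I (\<lambda>t. pairing (F t) \<phi>)"
  unfolding continuous_on_iff
proof (intro ballI allI impI)
  fix t e :: real assume te: "t \<in> I" "e > 0"
  obtain B where B: "\<And>x. cmod (\<phi> x) \<le> B" using test_functions_bounded[OF \<phi>] by blast
  define K where "K = \<bar>2 * pi * embed_const s * B\<bar> + 1"
  have K: "K > 0" "2 * pi * embed_const s * B \<le> K" by (auto simp: K_def)
  then have "e / K > 0" using te by simp
  with te(1) obtain d where d: "d > 0" "\<And>\<tau>. \<tau> \<in> I \<Longrightarrow> dist \<tau> t < d \<Longrightarrow> sobolev_norm s (F \<tau> - F t) < e / K"
    using curve_close[OF F] by blast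
  have "dist (pairing (F \<tau>) \<phi>) (pairing (F t) \<phi>) < e" if "\<tau> \<in> I" "dist \<tau> t < d" for \<tau>
  proof -
    have "dist (pairing (F \<tau>) \<phi>) (pairing (F t) \<phi>) \<le> 2 * pi * embed_const s * B * sobolev_norm s (F \<tau> - F t)"
      unfolding dist_norm pairing_minus[symmetric]
      by (intro pairing_sobolev_bound s \<phi> B sobolev_space_diff curveD[OF F] te that)
    also have "\<dots> \<le> K * sobolev_norm s (F \<tau> - F t)"
      by (intro mult_right_mono K sobolev_norm_nonneg)
    also have "\<dots> < e" using d(2)[OF that] K by (simp add: pos_less_divide_eq mult.commute)
    finally show ?thesis .
  qed
  then show "\<exists>d>0. \<forall>\<tau>\<in>I. dist \<tau> t < d \<longrightarrow> dist (pairing (F \<tau>) \<phi>) (pairing (F t) \<phi>) < e" using d(1) by auto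
qed

lemma curve_coeff_continuous:
  assumes "s > 1 / 2" "curve s I F"
  shows "continuous_on I (\<lambda>t. fourier_coeff (F t) k)"
proof -
  have "(\<lambda>t. fourier_coeff (F t) k) = (\<lambda>t. pairing (F t) (\<lambda>x. 1 * cis (of_int (- k) * x)) / of_real (2 * pi))"
    by (simp only: fourier_coeff_pairing mult_1_left) simp
  then show ?thesis
    by (simp only:) (intro continuous_intros curve_pairing_continuous[OF assms test_functions_monomial], simp)
qed

section \<open>Oriented time integrals of curves\<close>

lemma interval_integrable_continuous_oriented:
  fixes f :: "real \<Rightarrow> 'a :: {banach, second_countable_topology}"
  assumes "continuous_on {p..q} f" "a \<in> {p..q}" "b \<in> {p..q}"
  shows "interval_lebesgue_integrable lborel (ereal a) (ereal b) f"
proof (cases "a \<le> b")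
  case True
  then show ?thesis
    using assms by (intro interval_integrable_continuous_on continuous_on_subset[OF assms(1)]) auto
next
  case False
  then show ?thesis
    using assms by (subst interval_integrable_endpoints_reverse)
      (intro interval_integrable_continuous_on continuous_on_subset[OF assms(1)], auto)
qed

lemma interval_integral_norm_le:
  fixes f :: "real \<Rightarrow> complex"
  assumes "continuous_on {p..q} f" "a \<in> {p..q}" "b \<in> {p..q}" "\<And>t. t \<in> {p..q} \<Longrightarrow> cmod (f t) \<le> K"
  shows "cmod (LBINT t=ereal a..ereal b. f t) \<le> K * \<bar>b - a\<bar>"
proof -
  have le: "cmod (LBINT t=ereal a..ereal b. f t) \<le> K * (b - a)" if "a \<le> b" "a \<in> {p..q}" "b \<in> {p..q}" for a b
  proof -
    have cont: "continuous_on {a..b} f" using that by (intro continuous_on_subset[OF assms(1)]) auto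
    show ?thesis
      using that by (subst interval_integral_eq_integral)
        (auto intro!: integral_bound borel_integrable_atLeastAtMost' cont assms(4))
  qed
  show ?thesis
    using le[of a b] le[of b a] assms(2,3) interval_integral_endpoints_reverse[of "ereal a" "ereal b" f]
    by (cases "a \<le> b") auto
qed

context
  fixes s p q :: real and F :: "real \<Rightarrow> per_dist"
  assumes s: "s > 1 / 2" and F: "curve s {p..q} F"
begin

text \<open>Discharges the definite description. The curve is bounded in H^s, so its pairings are
  bounded by the supremum of the test function uniformly in time, and integrating them gives a
  distribution of order 0.\<close>

lemma pairing_dist_integral:
  assumes ab: "a \<in> {p..q}" "b \<in> {p..q}" and \<phi>: "\<phi> \<in> test_functions"
  shows "pairing (dist_integral a b F) \<phi> = (LBINT \<tau>=ereal a..ereal b. pairing (F \<tau>) \<phi>)"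
proof -
  let ?G = "\<lambda>\<phi>. if \<phi> \<in> test_functions then (LBINT \<tau>=ereal a..ereal b. pairing (F \<tau>) \<phi>) else 0"
  have int: "interval_lebesgue_integrable lborel (ereal a) (ereal b) (\<lambda>\<tau>. pairing (F \<tau>) \<phi>)" if "\<phi> \<in> test_functions" for \<phi>
    by (intro interval_integrable_continuous_oriented[OF curve_pairing_continuous[OF s F that] ab])
  obtain R where R: "R \<ge> 0" "\<And>t. t \<in> {p..q} \<Longrightarrow> sobolev_norm s (F t) \<le> R" using curve_bounded[OF F] by blast
  have add: "?G (\<lambda>x. \<phi> x + \<psi> x) = ?G \<phi> + ?G \<psi>" if "\<phi> \<in> test_functions" "\<psi> \<in> test_functions" for \<phi> \<psi>
    using test_functions_add(1)[OF that] that int[OF that(1)] int[OF that(2)] by (simp add: pairing_add[OF that])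
  have cmult: "?G (\<lambda>x. c * \<phi> x) = c * ?G \<phi>" if "\<phi> \<in> test_functions" for c \<phi>
    using test_functions_cmult(1)[OF that] that by (simp add: pairing_cmult[OF that])
  have bound: "cmod (?G \<phi>) \<le> (2 * pi * embed_const s * R * \<bar>b - a\<bar>) * B"
    if "\<phi> \<in> test_functions" "\<forall>j\<le>0. \<forall>x. cmod (vderiv j \<phi> x) \<le> B" for \<phi> B
  proof -
    have B: "cmod (\<phi> x) \<le> B" for x using that(2) by simp
    have B0: "0 \<le> B" using norm_ge_zero order_trans B[of 0] by blast
    have "cmod (pairing (F t) \<phi>) \<le> 2 * pi * embed_const s * B * R" if t: "t \<in> {p..q}" for t
    proof (rule order_trans[OF pairing_sobolev_bound[OF s curveD[OF F t] \<open>\<phi> \<in> test_functions\<close> B]])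
      have "embed_const s \<ge> 0" by (simp add: embed_const_def infsum_nonneg)
      then show "2 * pi * embed_const s * B * sobolev_norm s (F t) \<le> 2 * pi * embed_const s * B * R"
        using B0 by (intro mult_left_mono R t) auto
    qed
    from interval_integral_norm_le[OF curve_pairing_continuous[OF s F that(1)] ab this]
    show ?thesis using that(1) by (simp add: mult_ac)
  qed
  have "?G \<in> {F. (\<forall>\<phi>\<in>test_functions. \<forall>\<psi>\<in>test_functions. F (\<lambda>x. \<phi> x + \<psi> x) = F \<phi> + F \<psi>) \<and>
      (\<forall>c. \<forall>\<phi>\<in>test_functions. F (\<lambda>x. c * \<phi> x) = c * F \<phi>) \<and>
      (\<exists>C N. \<forall>\<phi>\<in>test_functions. \<forall>B.
          (\<forall>j\<le>N. \<forall>x. cmod (vderiv j \<phi> x) \<le> B) \<longrightarrow> cmod (F \<phi>) \<le> C * B) \<and>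
      (\<forall>\<phi>. \<phi> \<notin> test_functions \<longrightarrow> F \<phi> = 0)}"
    unfolding mem_Collect_eq
  proof (intro conjI ballI allI)
    show "\<exists>C N. \<forall>\<phi>\<in>test_functions. \<forall>B. (\<forall>j\<le>N. \<forall>x. cmod (vderiv j \<phi> x) \<le> B) \<longrightarrow> cmod (?G \<phi>) \<le> C * B"
      using bound by (intro exI[of _ "2 * pi * embed_const s * R * \<bar>b - a\<bar>"] exI[of _ "0::nat"]) blast
  qed (simp_all only: add cmult if_False simp_thms not_False_eq_True, simp)
  then have G: "pairing (Abs_per_dist ?G) = ?G" by (rule Abs_per_dist_inverse)
  have "\<forall>\<phi>\<in>test_functions. pairing (dist_integral a b F) \<phi> = (LBINT \<tau>=ereal a..ereal b. pairing (F \<tau>) \<phi>)"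
    unfolding dist_integral_def
  proof (rule theI[of _ "Abs_per_dist ?G"])
    fix w assume "\<forall>\<phi>\<in>test_functions. pairing w \<phi> = (LBINT \<tau>=ereal a..ereal b. pairing (F \<tau>) \<phi>)"
    then have "pairing w = pairing (Abs_per_dist ?G)"
      unfolding G by (auto simp: fun_eq_iff pairing_outside)
    then show "w = Abs_per_dist ?G" by (simp add: pairing_inject)
  qed (simp add: G)
  then show ?thesis using \<phi> by blast
qed

text \<open>Reduces the distribution-valued integral to scalar ones; its algebraic rules then follow
  coefficient by coefficient.\<close>

lemma fourier_coeff_dist_integral:
  assumes "a \<in> {p..q}" "b \<in> {p..q}"
  shows "fourier_coeff (dist_integral a b F) k = (LBINT \<tau>=ereal a..ereal b. fourier_coeff (F \<tau>) k)"
proof -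
  have "fourier_coeff (dist_integral a b F) k =
      1 / of_real (2 * pi) * (LBINT \<tau>=ereal a..ereal b. pairing (F \<tau>) (\<lambda>x. cis (of_int (- k) * x)))"
    using fourier_coeff_pairing[of "dist_integral a b F" k]
      pairing_dist_integral[OF assms test_functions_monomial[of 1 "- k"]] by (simp add: field_simps)
  also have "\<dots> = (LBINT \<tau>=ereal a..ereal b. fourier_coeff (F \<tau>) k)"
    by (simp only: fourier_coeff_pairing interval_lebesgue_integral_mult_right) simp
  finally show ?thesis .
qed

lemma dist_integral_reverse:
  assumes "a \<in> {p..q}" "b \<in> {p..q}"
  shows "dist_integral a b F = - dist_integral b a F"
  by (rule per_dist_eqI)
     (simp only: fourier_coeff_dist_integral[OF assms] fourier_coeff_dist_integral[OF assms(2,1)] fourier_coeff_uminus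
        interval_integral_endpoints_reverse[of "ereal a" "ereal b"])

lemma dist_integral_split:
  assumes "a \<in> {p..q}" "b \<in> {p..q}" "c \<in> {p..q}"
  shows "dist_integral a b F + dist_integral b c F = dist_integral a c F"
proof (rule per_dist_eqI)
  fix k
  have "interval_lebesgue_integrable lborel (ereal (min a (min b c))) (ereal (max a (max b c))) (\<lambda>t. fourier_coeff (F t) k)"
    using assms by (intro interval_integrable_continuous_oriented[OF curve_coeff_continuous[OF s F]]) auto
  then show "fourier_coeff (dist_integral a b F + dist_integral b c F) k = fourier_coeff (dist_integral a c F) k"
    using assms by (simp add: fourier_coeff_dist_integral fourier_coeff_add interval_integral_sum)
qed

text \<open>With \<open>b\<close> the coefficients of the integral, the square sum \<open>\<Sum> w\<^sub>k\<^sup>2 \<bar>b\<^sub>k\<bar>\<^sup>2\<close> over a finite set is the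
  integral of \<open>\<Sum> w\<^sub>k\<^sup>2 cnj b\<^sub>k F\<^sub>k\<close>; this yields Minkowski's inequality without a Bochner integral in \<open>H\<^sup>s\<close>.\<close>

lemma dist_integral_le:
  assumes ab: "a \<in> {p..q}" "b \<in> {p..q}" "a \<le> b"
    and g: "continuous_on {a..b} g" "\<And>t. t \<in> {a..b} \<Longrightarrow> sobolev_norm s (F t) \<le> g t"
  shows "dist_integral a b F \<in> sobolev_space s" "sobolev_norm s (dist_integral a b F) \<le> integral {a..b} g"
proof -
  let ?f = "\<lambda>k t. fourier_coeff (F t) k"
  define c where "c = fourier_coeff (dist_integral a b F)"
  have F': "curve s {a..b} F" using ab by (intro curve_subset[OF F]) auto
  have cont: "continuous_on {a..b} (?f k)" for k
    by (rule curve_coeff_continuous[OF s F'])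
  have c: "c k = integral {a..b} (?f k)" for k
    using ab by (simp add: c_def fourier_coeff_dist_integral)
      (intro interval_integral_eq_integral borel_integrable_atLeastAtMost' cont ab)
  have "L2_set (\<lambda>k. weight s k * cmod (c k)) S \<le> integral {a..b} g" if S: "finite S" for S
  proof -
    define L where "L = L2_set (\<lambda>k. weight s k * cmod (c k)) S"
    let ?h = "\<lambda>t. \<Sum>k\<in>S. (of_real ((weight s k)\<^sup>2) * cnj (c k)) * ?f k t"
    have h: "?h integrable_on {a..b}"
      by (intro integrable_continuous_interval continuous_intros cont)
    have "complex_of_real (L\<^sup>2) = (\<Sum>k\<in>S. (of_real ((weight s k)\<^sup>2) * cnj (c k)) * c k)"
    proof -
      have "cnj z * z = complex_of_real ((cmod z)\<^sup>2)" for z by (metis complex_norm_square mult.commute)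
      then show ?thesis
        by (simp add: L_def L2_set_def sum_nonneg power_mult_distrib mult.assoc)
    qed
    also have "\<dots> = integral {a..b} ?h"
      unfolding c using S by (subst integral_sum) (auto intro!: integrable_continuous_interval continuous_intros cont)
    finally have "L\<^sup>2 = cmod (integral {a..b} ?h)"
      by (metis norm_of_real abs_of_nonneg zero_le_power2)
    also have "\<dots> \<le> integral {a..b} (\<lambda>t. L * g t)"
    proof (rule integral_norm_bound_integral[OF h])
      show "(\<lambda>t. L * g t) integrable_on {a..b}"
        by (intro integrable_continuous_interval continuous_intros g)
      fix t assume t: "t \<in> {a..b}"
      have "cmod (?h t) \<le> (\<Sum>k\<in>S. \<bar>weight s k * cmod (c k)\<bar> * \<bar>weight s k * cmod (?f k t)\<bar>)"
        by (rule order_trans[OF norm_sum]) (simp add: norm_mult abs_mult power2_eq_square mult_ac norm_power abs_of_pos[OF weight_pos])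
      also have "\<dots> \<le> L * L2_set (\<lambda>k. weight s k * cmod (?f k t)) S"
        unfolding L_def by (rule L2_set_mult_ineq)
      also have "\<dots> \<le> L * g t"
        using curveD[OF F' t] g(2)[OF t]
        by (intro mult_left_mono order_trans[OF L2_set_le_seq_norm])
          (auto simp: L_def sobolev_space_iff sobolev_norm_seq_norm)
      finally show "cmod (?h t) \<le> L * g t" .
    qed
    also have "\<dots> = L * integral {a..b} g" by simp
    finally have "L * L \<le> L * integral {a..b} g" by (simp add: power2_eq_square)
    \<comment> \<open>When \<open>L\<close> is 0 it cannot be cancelled, and nonnegativity of the
      bound takes its place.\<close>
    moreover have "0 \<le> integral {a..b} g"
      using g(2) order_trans[OF sobolev_norm_nonneg g(2)]
      by (intro integral_nonneg integrable_continuous_interval g) auto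
    moreover have "0 \<le> L" by (simp add: L_def)
    ultimately have "L \<le> integral {a..b} g" by (cases "L = 0") auto
    then show ?thesis by (simp add: L_def)
  qed
  note mem = seq_spaceI[OF this]
  have "c (- k) = cnj (c k)" for k
  proof -
    have "cnj (c k) = integral {a..b} (\<lambda>t. cnj (?f k t))" unfolding c by (rule integral_cnj)
    also have "\<dots> = c (- k)"
      unfolding c using curveD[OF F'] by (intro integral_cong real_valued_fourier_coeff[symmetric]) (auto simp: sobolev_space_iff)
    finally show ?thesis by simp
  qed
  then have "real_valued (dist_integral a b F)"
    using seq_space_abs_summable(1)[OF s mem(1)] by (intro real_valuedI) (auto simp: c_def)
  then show "dist_integral a b F \<in> sobolev_space s" "sobolev_norm s (dist_integral a b F) \<le> integral {a..b} g"
    using mem by (auto simp: sobolev_space_iff c_def sobolev_norm_seq_norm)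
qed

lemma dist_integral_sobolev_space:
  assumes "a \<in> {p..q}" "b \<in> {p..q}"
  shows "dist_integral a b F \<in> sobolev_space s"
proof -
  \<comment> \<open>The norm of the curve is itself an admissible continuous majorant.\<close>
  have le: "dist_integral a b F \<in> sobolev_space s" if "a \<in> {p..q}" "b \<in> {p..q}" "a \<le> b" for a b
    using that by (intro dist_integral_le(1)[OF that, of "\<lambda>t. sobolev_norm s (F t)"] curve_norm_continuous curve_subset[OF F]) auto
  show ?thesis
    using le[of a b] le[of b a] assms dist_integral_reverse[OF assms] sobolev_space_uminus
    by (cases "a \<le> b") auto
qed

lemma dist_integral_norm_le:
  assumes "a \<in> {p..q}" "b \<in> {p..q}" "\<And>t. t \<in> {p..q} \<Longrightarrow> sobolev_norm s (F t) \<le> K"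
  shows "sobolev_norm s (dist_integral a b F) \<le> K * \<bar>b - a\<bar>"
proof -
  have le: "sobolev_norm s (dist_integral a b F) \<le> K * (b - a)" if "a \<in> {p..q}" "b \<in> {p..q}" "a \<le> b" for a b
    using dist_integral_le(2)[OF that, of "\<lambda>_. K"] that assms(3) by simp (simp add: mult.commute)
  have "sobolev_norm s (dist_integral a b F) = sobolev_norm s (dist_integral b a F)"
    using dist_integral_reverse[OF assms(1,2)] by (simp add: sobolev_norm_uminus)
  then show ?thesis using le[of a b] le[of b a] assms by (cases "a \<le> b") auto
qed

text \<open>Integrating the exponential gains the factor 1 / l, the source of the contraction in the
  weighted norm. The boundary term at 0 has a favourable sign because \<open>K\<close> is
  nonnegative. Negative times are treated by reversing the orientation.\<close>

lemma dist_integral_exp_le: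
  assumes 0: "0 \<in> {p..q}" and t: "t \<in> {p..q}" and l: "l > 0"
    and F_le: "\<And>\<tau>. \<tau> \<in> {p..q} \<Longrightarrow> sobolev_norm s (F \<tau>) \<le> K * exp (l * \<bar>\<tau>\<bar>)"
  shows "sobolev_norm s (dist_integral 0 t F) \<le> K / l * exp (l * \<bar>t\<bar>)"
proof -
  have K: "0 \<le> K" using order_trans[OF sobolev_norm_nonneg F_le[OF 0]] by simp
  show ?thesis
  proof (cases "t \<ge> 0")
    case True
    have int: "((\<lambda>\<tau>. K * exp (l * \<tau>)) has_integral (K / l * exp (l * t) - K / l * exp (l * 0))) {0..t}"
      using True l by (intro fundamental_theorem_of_calculus)
        (auto intro!: derivative_eq_intros simp: has_real_derivative_iff_has_vector_derivative[symmetric])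
    have "integral {0..t} (\<lambda>\<tau>. K * exp (l * \<tau>)) \<le> K / l * exp (l * \<bar>t\<bar>)"
      unfolding integral_unique[OF int] using True K l by (simp add: field_simps)
    moreover have "sobolev_norm s (dist_integral 0 t F) \<le> integral {0..t} (\<lambda>\<tau>. K * exp (l * \<tau>))"
    proof (rule dist_integral_le(2)[OF 0 t])
      show "sobolev_norm s (F \<tau>) \<le> K * exp (l * \<tau>)" if "\<tau> \<in> {0..t}" for \<tau>
        using F_le[of \<tau>] that t 0 by simp
    qed (use True in \<open>auto intro!: continuous_intros\<close>)
    ultimately show ?thesis by simp
  next
    case False
    have int: "((\<lambda>\<tau>. K * exp (- l * \<tau>)) has_integral (- K / l * exp (- l * 0) - (- K / l * exp (- l * t)))) {t..0}"
      using False l by (intro fundamental_theorem_of_calculus)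
        (auto intro!: derivative_eq_intros simp: has_real_derivative_iff_has_vector_derivative[symmetric])
    have "integral {t..0} (\<lambda>\<tau>. K * exp (- l * \<tau>)) \<le> K / l * exp (l * \<bar>t\<bar>)"
      unfolding integral_unique[OF int] using False K l by (simp add: field_simps)
    moreover have "sobolev_norm s (dist_integral t 0 F) \<le> integral {t..0} (\<lambda>\<tau>. K * exp (- l * \<tau>))"
    proof (rule dist_integral_le(2)[OF t 0])
      show "sobolev_norm s (F \<tau>) \<le> K * exp (- l * \<tau>)" if "\<tau> \<in> {t..0}" for \<tau>
        using F_le[of \<tau>] that t 0 by simp
    qed (use False in \<open>auto intro!: continuous_intros\<close>)
    moreover have "sobolev_norm s (dist_integral 0 t F) = sobolev_norm s (dist_integral t 0 F)"
      using dist_integral_reverse[OF 0 t] by (simp add: sobolev_norm_uminus)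
    ultimately show ?thesis by simp
  qed
qed

end

lemma dist_integral_diff:
  assumes s: "s > 1 / 2" and F: "curve s {p..q} F" and G: "curve s {p..q} G"
    and ab: "a \<in> {p..q}" "b \<in> {p..q}"
  shows "dist_integral a b F - dist_integral a b G = dist_integral a b (\<lambda>t. F t - G t)"
proof (rule per_dist_eqI)
  fix k
  note int = interval_integrable_continuous_oriented[OF curve_coeff_continuous[OF s] ab]
  show "fourier_coeff (dist_integral a b F - dist_integral a b G) k = fourier_coeff (dist_integral a b (\<lambda>t. F t - G t)) k"
    using int[OF F, of k] int[OF G, of k]
    by (simp add: fourier_coeff_diff fourier_coeff_dist_integral[OF s F ab] fourier_coeff_dist_integral[OF s G ab]
        fourier_coeff_dist_integral[OF s curve_diff[OF F G] ab])
qed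

section \<open>The integral equation\<close>

lemma is_solution_nonlin:
  "is_solution T v u \<longleftrightarrow> (\<forall>t\<in>{-T..T}. u t = v + dist_integral 0 t (\<lambda>\<tau>. nonlin (u \<tau>)))"
  by (simp add: is_solution_def nonlin_def)

text \<open>\<open>cfunspace\<close> also demands a bounded image, which continuity on the compact
  interval provides.\<close>

lemma mspace_sobolev_curves:
  "u \<in> mspace (sobolev_curves s T) \<longleftrightarrow> u \<in> extensional {-T..T} \<and> curve s {-T..T} u"
proof -
  have "sobolev.mbounded s (u ` {-T..T})" if u: "curve s {-T..T} u"
  proof -
    obtain R where "\<And>t. t \<in> {-T..T} \<Longrightarrow> sobolev_norm s (u t) \<le> R" using curve_bounded[OF u] by blast
    then have "u ` {-T..T} \<subseteq> sobolev.mcball s 0 R"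
      using curveD[OF u] sobolev_space_0 by (auto simp: sobolev_norm_uminus)
    then show ?thesis unfolding sobolev.mbounded_def by blast
  qed
  then show ?thesis
    unfolding sobolev_curves_def mspace_cfunspace continuous_map_iff_curve by (auto dest: curveD)
qed

lemma mdist_sobolev_curves_le:
  assumes "u \<in> mspace (sobolev_curves s T)" "v \<in> mspace (sobolev_curves s T)" "T > 0"
  shows "mdist (sobolev_curves s T) u v \<le> a \<longleftrightarrow> (\<forall>t\<in>{-T..T}. sobolev_norm s (u t - v t) \<le> a)"
  using cfunspace_mdist_le[of u "top_of_set {-T..T}" "sobolev_metric s" v a] assms
  unfolding sobolev_curves_def by simp

text \<open>The integral is Lipschitz in its upper limit, with a bound of the integrand as
  constant.\<close>

lemma curve_integral:
  assumes s: "s > 1 / 2" and F: "curve s {p..q} F" and v: "v \<in> sobolev_space s" and 0: "0 \<in> {p..q}"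
  shows "curve s {p..q} (\<lambda>t. v + dist_integral 0 t F)"
  unfolding curve_def
proof (intro conjI ballI allI impI)
  fix t assume "t \<in> {p..q}"
  then show "v + dist_integral 0 t F \<in> sobolev_space s"
    by (intro sobolev_space_add v dist_integral_sobolev_space[OF s F] 0)
next
  fix t e :: real assume te: "t \<in> {p..q}" "e > 0"
  obtain K where K: "K \<ge> 0" "\<And>t. t \<in> {p..q} \<Longrightarrow> sobolev_norm s (F t) \<le> K" using curve_bounded[OF F] by blast
  have "sobolev_norm s (v + dist_integral 0 \<tau> F - (v + dist_integral 0 t F)) < e"
    if "\<tau> \<in> {p..q}" "dist \<tau> t < e / (K + 1)" for \<tau>
  proof -
    have "v + dist_integral 0 \<tau> F - (v + dist_integral 0 t F) = dist_integral t \<tau> F"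
      using dist_integral_split[OF s F 0 te(1) that(1)] by (simp add: algebra_simps)
    then have "sobolev_norm s (v + dist_integral 0 \<tau> F - (v + dist_integral 0 t F)) \<le> K * \<bar>\<tau> - t\<bar>"
      using dist_integral_norm_le[OF s F te(1) that(1) K(2)] by simp
    also have "\<dots> \<le> (K + 1) * \<bar>\<tau> - t\<bar>" by (simp add: mult_right_mono)
    also have "\<dots> < e" using that(2) K(1) by (simp add: dist_real_def pos_less_divide_eq mult.commute)
    finally show ?thesis .
  qed
  moreover have "e / (K + 1) > 0" using te K by simp
  ultimately show "\<exists>d>0. \<forall>\<tau>\<in>{p..q}. dist \<tau> t < d \<longrightarrow>
      sobolev_norm s (v + dist_integral 0 \<tau> F - (v + dist_integral 0 t F)) < e" by blast
qed

text \<open>The weight \<open>exp (- l \<bar>t\<bar>)\<close> makes the integral operator a contraction on any time interval.\<close>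

lemma solution_stability:
  assumes s: "s > 1 / 2" and T: "T > 0"
    and u: "curve s {-T..T} u" "is_solution T v u" and w: "curve s {-T..T} w" "is_solution T z w"
    and vz: "v \<in> sobolev_space s" "z \<in> sobolev_space s"
    and R: "\<And>t. t \<in> {-T..T} \<Longrightarrow> sobolev_norm s (u t) \<le> R" "\<And>t. t \<in> {-T..T} \<Longrightarrow> sobolev_norm s (w t) \<le> R"
    and t: "t \<in> {-T..T}"
  shows "sobolev_norm s (u t - w t) \<le> 2 * exp (2 * (1 + algebra_const s * R) * T) * sobolev_norm s (v - z)"
proof -
  define L where "L = 1 + algebra_const s * R"
  \<comment> \<open>Twice the Lipschitz constant, so that the integral operator has weighted norm at
    most L / l = 1/2.\<close>
  define l where "l = 2 * L"
  have I0: "0 \<in> {-T..T}" using T by simp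
  have "R \<ge> 0" using order_trans[OF sobolev_norm_nonneg R(1)[OF I0]] .
  then have L: "L > 0" using algebra_const_nonneg[of s] by (simp add: L_def add_pos_nonneg)
  then have l: "l > 0" by (simp add: l_def)
  let ?f = "\<lambda>t. exp (- l * \<bar>t\<bar>) * sobolev_norm s (u t - w t)"
  note Nu = curve_nonlin[OF s u(1)] and Nw = curve_nonlin[OF s w(1)]
  have "continuous_on {-T..T} ?f"
    by (intro continuous_intros curve_norm_continuous[OF curve_diff[OF u(1) w(1)]])
  \<comment> \<open>The weighted supremum is attained by compactness; the integral inequality can
    thus be evaluated at the maximiser \<open>m\<close>.\<close>
  then obtain m where m: "m \<in> {-T..T}" "\<And>t. t \<in> {-T..T} \<Longrightarrow> ?f t \<le> ?f m"
    using continuous_attains_sup[of "{-T..T}" ?f] T by auto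
  define D where "D = ?f m"
  have D: "sobolev_norm s (u t - w t) \<le> D * exp (l * \<bar>t\<bar>)" if "t \<in> {-T..T}" for t
    using mult_right_mono[OF m(2)[OF that], of "exp (l * \<bar>t\<bar>)"] 
    by (simp add: D_def exp_minus field_simps)
  have "sobolev_norm s (nonlin (u t) - nonlin (w t)) \<le> L * D * exp (l * \<bar>t\<bar>)" if "t \<in> {-T..T}" for t
  proof -
    have "sobolev_norm s (nonlin (u t) - nonlin (w t)) \<le> L * sobolev_norm s (u t - w t)"
      unfolding L_def by (intro nonlin_Lipschitz s R curveD[OF u(1)] curveD[OF w(1)] that)
    also have "\<dots> \<le> L * (D * exp (l * \<bar>t\<bar>))" using L D[OF that] by (intro mult_left_mono) auto
    finally show ?thesis by (simp add: mult.assoc)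
  qed
  note int_le = dist_integral_exp_le[OF s curve_diff[OF Nu Nw] I0 _ l this]
  have le: "sobolev_norm s (u t - w t) \<le> sobolev_norm s (v - z) + D / 2 * exp (l * \<bar>t\<bar>)" if "t \<in> {-T..T}" for t
  proof -
    let ?J = "dist_integral 0 t (\<lambda>\<tau>. nonlin (u \<tau>) - nonlin (w \<tau>))"
    have "u t - w t = (v - z) + (dist_integral 0 t (\<lambda>\<tau>. nonlin (u \<tau>)) - dist_integral 0 t (\<lambda>\<tau>. nonlin (w \<tau>)))"
      using u(2) w(2) that unfolding is_solution_nonlin by (simp add: algebra_simps)
    then have "u t - w t = (v - z) + ?J"
      by (simp only: dist_integral_diff[OF s Nu Nw I0 that])
    then have "sobolev_norm s (u t - w t) \<le> sobolev_norm s (v - z) + sobolev_norm s ?J"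
      using vz dist_integral_sobolev_space[OF s curve_diff[OF Nu Nw] I0 that]
      by (simp only:) (intro sobolev_norm_add sobolev_space_diff)
    also have "sobolev_norm s ?J \<le> L * D / l * exp (l * \<bar>t\<bar>)" by (rule int_le[OF that])
    also have "L * D / l = D / 2" using L by (simp add: l_def)
    finally show ?thesis by simp
  qed
  \<comment> \<open>At \<open>m\<close> the weight cancels the exponential, and the term D / 2 is
    absorbed on the left.\<close>
  have "D \<le> sobolev_norm s (v - z) + D / 2"
  proof -
    have "D \<le> exp (- l * \<bar>m\<bar>) * (sobolev_norm s (v - z) + D / 2 * exp (l * \<bar>m\<bar>))"
      unfolding D_def by (intro mult_left_mono le[OF m(1), unfolded D_def]) auto
    also have "\<dots> = exp (- l * \<bar>m\<bar>) * sobolev_norm s (v - z) + D / 2"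
      by (simp add: exp_minus field_simps)
    also have "exp (- l * \<bar>m\<bar>) * sobolev_norm s (v - z) \<le> 1 * sobolev_norm s (v - z)"
      using l by (intro mult_right_mono sobolev_norm_nonneg) simp
    finally show ?thesis by simp
  qed
  then have D2: "D \<le> 2 * sobolev_norm s (v - z)" by simp
  have "sobolev_norm s (u t - w t) \<le> D * exp (l * \<bar>t\<bar>)" by (rule D[OF t])
  also have "\<dots> \<le> (2 * sobolev_norm s (v - z)) * exp (l * T)"
    using t l D2 by (intro mult_mono) (auto simp: sobolev_norm_nonneg)
  finally show ?thesis by (simp add: l_def L_def mult_ac)
qed

text \<open>No size restriction on the competitors: two given curves on a compact interval always
  have a common bound, and stability with equal data leaves distance 0. Extensionality upgrades
  agreement on the interval to equality of functions.\<close>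

lemma solution_unique:
  assumes s: "s > 1 / 2" and T: "T > 0" and v: "v \<in> sobolev_space s"
    and u: "u \<in> mspace (sobolev_curves s T)" "is_solution T v u"
    and w: "w \<in> mspace (sobolev_curves s T)" "is_solution T v w"
  shows "u = w"
proof (rule extensionalityI)
  have curves: "curve s {-T..T} u" "curve s {-T..T} w" and "u \<in> extensional {-T..T}" "w \<in> extensional {-T..T}"
    using u w by (simp_all add: mspace_sobolev_curves)
  then show "u \<in> extensional {-T..T}" "w \<in> extensional {-T..T}" by simp_all
  obtain R S where R: "\<And>t. t \<in> {-T..T} \<Longrightarrow> sobolev_norm s (u t) \<le> R"
    and S: "\<And>t. t \<in> {-T..T} \<Longrightarrow> sobolev_norm s (w t) \<le> S"
    using curve_bounded[OF curves(1)] curve_bounded[OF curves(2)] by metis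
  fix t assume t: "t \<in> {-T..T}"
  have "sobolev_norm s (u t - w t) \<le> 2 * exp (2 * (1 + algebra_const s * max R S) * T) * sobolev_norm s (v - v)"
    by (rule solution_stability[OF s T curves(1) u(2) curves(2) w(2) v v
          order_trans[OF R max.cobounded1] order_trans[OF S max.cobounded2] t])
  then have "sobolev_norm s (u t - w t) = 0"
    using sobolev_norm_nonneg[of s "u t - w t"] by (simp add: sobolev_norm_0)
  then show "u t = w t"
    using sobolev_norm_eq_0[OF sobolev_space_diff[OF curveD[OF curves(1) t] curveD[OF curves(2) t]]] by simp
qed

text \<open>The ball is centred at the zero curve and has radius R = 2 r. As the nonlinearity
  vanishes at 0, an iterate has norm at most r + T L R, which is at most r + R / 2 = R; the same
  smallness gives the contraction factor 1/2. The bound 2 r is kept in the conclusion because the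
  stability estimate needs it.\<close>

lemma solution_exists:
  assumes s: "s > 1 / 2" and T: "T > 0" and v: "v \<in> sobolev_space s" "sobolev_norm s v \<le> r"
    and small: "T * (1 + algebra_const s * (2 * r)) \<le> 1 / 2"
  shows "\<exists>u\<in>mspace (sobolev_curves s T). is_solution T v u \<and> (\<forall>t\<in>{-T..T}. sobolev_norm s (u t) \<le> 2 * r)"
proof -
  define R where "R = 2 * r"
  define L where "L = 1 + algebra_const s * R"
  define m where "m = sobolev_curves s T"
  \<comment> \<open>The restriction to \<open>{-T..T}\<close> keeps the iterates extensional, as
    membership in \<open>sobolev_curves\<close> requires.\<close>
  define \<Phi> where "\<Phi> = (\<lambda>u. \<lambda>t\<in>{-T..T}. v + dist_integral 0 t (\<lambda>\<tau>. nonlin (u \<tau>)))"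
  define z where "z = (\<lambda>t\<in>{-T..T}. 0 :: per_dist)"
  have r: "0 \<le> r" using order_trans[OF sobolev_norm_nonneg v(2)] .
  have L: "L > 0" "T * L \<le> 1 / 2"
    using algebra_const_nonneg[of s] r small by (auto simp: L_def R_def intro!: add_pos_nonneg)
  have I0: "0 \<in> {-T..T}" using T by simp
  have z: "z \<in> mspace m"
    unfolding m_def mspace_sobolev_curves z_def curve_def by (auto simp: sobolev_space_0 sobolev_norm_0 intro: exI[of _ 1])
  interpret M: Metric_space "mspace m" "mdist m" by (rule Metric_space_mspace_mdist)
  define X where "X = M.mcball z R"
  have X: "u \<in> X \<longleftrightarrow> u \<in> extensional {-T..T} \<and> curve s {-T..T} u \<and> (\<forall>t\<in>{-T..T}. sobolev_norm s (u t) \<le> R)" for u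
  proof -
    have "u \<in> X \<longleftrightarrow> u \<in> mspace m \<and> mdist m z u \<le> R"
      unfolding X_def M.in_mcball using z by simp
    also have "\<dots> \<longleftrightarrow> u \<in> mspace m \<and> (\<forall>t\<in>{-T..T}. sobolev_norm s (u t) \<le> R)"
      using mdist_sobolev_curves_le[OF z[unfolded m_def] _ T, of u R]
      by (auto simp: m_def z_def sobolev_norm_uminus)
    finally show ?thesis by (simp add: m_def mspace_sobolev_curves)
  qed
  have "X \<subseteq> mspace m" unfolding X_def by (rule M.mcball_subset_mspace)
  interpret S: Submetric "mspace m" "mdist m" X
    by unfold_locales (fact \<open>X \<subseteq> mspace m\<close>)
  have "M.mcomplete"
    using sobolev.mcomplete_cfunspace[OF sobolev_mcomplete[OF s], of "top_of_set {-T..T}"]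
    unfolding mcomplete_of_def m_def sobolev_curves_def sobolev_metric_def sobolev.Self_def .
  \<comment> \<open>A closed ball in the complete space of curves is complete.\<close>
  then have complete: "S.sub.mcomplete"
    by (intro S.closedin_mcomplete_imp_mcomplete) (simp_all add: X_def)
  have nonlin_le: "sobolev_norm s (nonlin (u t)) \<le> L * R" if "u \<in> X" "t \<in> {-T..T}" for u t
  proof -
    have "sobolev_norm s (nonlin (u t) - nonlin 0) \<le> L * sobolev_norm s (u t - 0)"
      unfolding L_def using that r by (intro nonlin_Lipschitz s sobolev_space_0) (auto simp: X R_def sobolev_norm_0 dest: curveD)
    also have "\<dots> \<le> L * R" using that L by (intro mult_left_mono) (auto simp: X)
    finally show ?thesis by (simp add: nonlin_0)
  qed
  have Nu: "curve s {-T..T} (\<lambda>t. nonlin (u t))" if "u \<in> X" for u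
    using that by (intro curve_nonlin s) (simp add: X)
  have \<Phi>_X: "\<Phi> u \<in> X" if u: "u \<in> X" for u
    unfolding X
  proof (intro conjI ballI)
    show "\<Phi> u \<in> extensional {-T..T}" by (simp add: \<Phi>_def)
    have "curve s {-T..T} (\<lambda>t. v + dist_integral 0 t (\<lambda>\<tau>. nonlin (u \<tau>)))"
      by (intro curve_integral s Nu u v I0)
    then show "curve s {-T..T} (\<Phi> u)"
      by (subst curve_cong[of _ "\<Phi> u"]) (auto simp: \<Phi>_def)
    fix t assume t: "t \<in> {-T..T}"
    have "sobolev_norm s (\<Phi> u t) \<le> sobolev_norm s v + sobolev_norm s (dist_integral 0 t (\<lambda>\<tau>. nonlin (u \<tau>)))"
      using t by (simp add: \<Phi>_def) (intro sobolev_norm_add v dist_integral_sobolev_space[OF s Nu[OF u] I0], simp)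
    also have "\<dots> \<le> r + L * R * \<bar>t - 0\<bar>"
      by (intro add_mono v dist_integral_norm_le[OF s Nu[OF u] I0 t] nonlin_le[OF u])
    also have "\<dots> \<le> r + L * R * T"
      using t L r by (intro add_left_mono mult_left_mono) (auto simp: R_def)
    also have "\<dots> \<le> r + R * (1 / 2)"
      using mult_left_mono[OF L(2), of R] r by (simp add: R_def mult_ac)
    finally show "sobolev_norm s (\<Phi> u t) \<le> R" by (simp add: R_def)
  qed
  have contraction: "mdist m (\<Phi> u) (\<Phi> w) \<le> 1 / 2 * mdist m u w" if u: "u \<in> X" and w: "w \<in> X" for u w
  proof -
    note mem = subsetD[OF \<open>X \<subseteq> mspace m\<close>]
    have d: "sobolev_norm s (u t - w t) \<le> mdist m u w" if "t \<in> {-T..T}" for t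
      using mdist_sobolev_curves_le[OF mem[OF u, unfolded m_def] mem[OF w, unfolded m_def] T, of "mdist m u w"] that
      by (simp add: m_def)
    have N: "sobolev_norm s (nonlin (u t) - nonlin (w t)) \<le> L * mdist m u w" if "t \<in> {-T..T}" for t
    proof -
      have "sobolev_norm s (nonlin (u t) - nonlin (w t)) \<le> L * sobolev_norm s (u t - w t)"
        unfolding L_def using u w that by (intro nonlin_Lipschitz s) (auto simp: X dest: curveD)
      also have "\<dots> \<le> L * mdist m u w" using L d[OF that] by (intro mult_left_mono) auto
      finally show ?thesis .
    qed
    have "sobolev_norm s (\<Phi> u t - \<Phi> w t) \<le> 1 / 2 * mdist m u w" if t: "t \<in> {-T..T}" for t
    proof -
      have "\<Phi> u t - \<Phi> w t = dist_integral 0 t (\<lambda>\<tau>. nonlin (u \<tau>) - nonlin (w \<tau>))"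
        using t dist_integral_diff[OF s Nu[OF u] Nu[OF w] I0 t] by (simp add: \<Phi>_def)
      then have "sobolev_norm s (\<Phi> u t - \<Phi> w t) \<le> L * mdist m u w * \<bar>t - 0\<bar>"
        using dist_integral_norm_le[OF s curve_diff[OF Nu[OF u] Nu[OF w]] I0 t N] by simp
      also have "\<dots> \<le> L * mdist m u w * T"
        using t L by (intro mult_left_mono) auto
      also have "\<dots> \<le> 1 / 2 * mdist m u w"
        using mult_right_mono[OF L(2) M.nonneg, of u w] by (simp add: mult_ac)
      finally show ?thesis .
    qed
    then show ?thesis
      using mdist_sobolev_curves_le[OF mem[OF \<Phi>_X[OF u], unfolded m_def] mem[OF \<Phi>_X[OF w], unfolded m_def] T,
          of "1 / 2 * mdist m u w"]
      unfolding m_def by blast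
  qed
  have "z \<in> X" using z r by (simp add: X_def R_def)
  then obtain u where u: "u \<in> X" "\<Phi> u = u"
    using S.sub.Banach_fixedpoint_thm[OF complete, of \<Phi> "1 / 2"] \<Phi>_X contraction by auto
  have "is_solution T v u"
    unfolding is_solution_nonlin
  proof
    fix t assume t: "t \<in> {-T..T}"
    have "u t = \<Phi> u t" by (simp add: u(2))
    then show "u t = v + dist_integral 0 t (\<lambda>\<tau>. nonlin (u \<tau>))" using t by (simp add: \<Phi>_def)
  qed
  moreover have "u \<in> mspace (sobolev_curves s T)" using u(1) \<open>X \<subseteq> mspace m\<close> by (auto simp: m_def)
  ultimately show ?thesis using u(1) by (auto simp: X R_def)
qed

theorem theorem3p1:
  fixes s :: real
  assumes "s > 1 / 2"
  shows "\<exists>T :: real \<Rightarrow> real. \<forall>u\<^sub>0 \<in> sobolev_space s.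
    T (sobolev_norm s u\<^sub>0) > 0 \<and>
    (\<exists>!u. u \<in> mspace (sobolev_curves s (T (sobolev_norm s u\<^sub>0))) \<and>
          is_solution (T (sobolev_norm s u\<^sub>0)) u\<^sub>0 u) \<and>
    (\<forall>T'. 0 < T' \<and> T' < T (sobolev_norm s u\<^sub>0) \<longrightarrow>
      (\<exists>V U F. V \<subseteq> sobolev_space s \<and>
         openin (mtopology_of (sobolev_metric s)) U \<and> u\<^sub>0 \<in> U \<and> U \<subseteq> V \<and>
         (\<forall>v\<in>V. \<forall>u \<in> mspace (sobolev_curves s T'). is_solution T' v u \<longleftrightarrow> u = F v) \<and>
         Lipschitz_continuous_map (submetric (sobolev_metric s) V) (sobolev_curves s T') F))"
proof -
  \<comment> \<open>The argument r + 1 allows for data in the unit ball about a datum of norm r.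
    Their solutions have norm at most 2 (r + 1), and T is half the reciprocal of the Lipschitz
    constant on that ball.\<close>
  define T where "T r = 1 / (2 * (1 + algebra_const s * (2 * (r + 1))))" for r
  have T: "T r > 0" "T r * (1 + algebra_const s * (2 * (r + 1))) \<le> 1 / 2" if "r \<ge> 0" for r
  proof -
    have "1 + algebra_const s * (2 * (r + 1)) > 0"
      using that algebra_const_nonneg[of s] by (intro add_pos_nonneg) auto
    then show "T r > 0" "T r * (1 + algebra_const s * (2 * (r + 1))) \<le> 1 / 2"
      by (simp_all add: T_def)
  qed
  show ?thesis
  proof (intro exI[of _ T] ballI conjI allI impI)
    fix u\<^sub>0 assume u\<^sub>0: "u\<^sub>0 \<in> sobolev_space s"
    let ?r = "sobolev_norm s u\<^sub>0"
    note Tr = T[OF sobolev_norm_nonneg[of s u\<^sub>0]]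
    show "T ?r > 0" by (rule Tr)
    have "\<exists>u\<in>mspace (sobolev_curves s (T ?r)). is_solution (T ?r) u\<^sub>0 u \<and>
        (\<forall>t\<in>{- T ?r..T ?r}. sobolev_norm s (u t) \<le> 2 * (?r + 1))"
      by (rule solution_exists[OF assms Tr(1) u\<^sub>0 _ Tr(2)]) simp
    then show "\<exists>!u. u \<in> mspace (sobolev_curves s (T ?r)) \<and> is_solution (T ?r) u\<^sub>0 u"
      using solution_unique[OF assms Tr(1) u\<^sub>0] by blast
    fix T' assume T': "0 < T' \<and> T' < T ?r"
    \<comment> \<open>The open unit ball serves both as the domain \<open>V\<close> and as the open
      neighbourhood \<open>U\<close>.\<close>
    define V where "V = sobolev.mball s u\<^sub>0 1"
    define R where "R = 2 * (?r + 1)"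
    have "T' * (1 + algebra_const s * R) \<le> T ?r * (1 + algebra_const s * R)"
      using T' algebra_const_nonneg[of s] by (intro mult_right_mono) (auto simp: R_def sobolev_norm_nonneg)
    also have "\<dots> \<le> 1 / 2" using Tr(2) by (simp add: R_def)
    finally have small: "T' * (1 + algebra_const s * R) \<le> 1 / 2" .
    have V: "v \<in> sobolev_space s" "sobolev_norm s v \<le> ?r + 1" if "v \<in> V" for v
    proof -
      show v: "v \<in> sobolev_space s" using that by (simp add: V_def)
      show "sobolev_norm s v \<le> ?r + 1"
        using that sobolev_norm_triangle_abs[OF u\<^sub>0 v] unfolding V_def sobolev.in_mball by linarith
    qed
    have "\<exists>u\<in>mspace (sobolev_curves s T'). is_solution T' v u \<and> (\<forall>t\<in>{-T'..T'}. sobolev_norm s (u t) \<le> R)" if "v \<in> V" for v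
      using solution_exists[OF assms _ V[OF that], of T'] T' small by (simp add: R_def)
    \<comment> \<open>The flow is chosen together with the bound \<open>R\<close> common to all data
      in \<open>V\<close>, which makes the stability constant independent of the pair of
      data.\<close>
    then obtain F where F: "\<And>v. v \<in> V \<Longrightarrow> F v \<in> mspace (sobolev_curves s T')"
      "\<And>v. v \<in> V \<Longrightarrow> is_solution T' v (F v)"
      "\<And>v t. v \<in> V \<Longrightarrow> t \<in> {-T'..T'} \<Longrightarrow> sobolev_norm s (F v t) \<le> R"
      by metis
    have "Lipschitz_continuous_map (submetric (sobolev_metric s) V) (sobolev_curves s T') F"
      unfolding Lipschitz_continuous_map_def
    proof (intro conjI exI ballI)
      show "F \<in> mspace (submetric (sobolev_metric s) V) \<rightarrow> mspace (sobolev_curves s T')"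
        using F(1) by auto
      fix v w assume vw: "v \<in> mspace (submetric (sobolev_metric s) V)" "w \<in> mspace (submetric (sobolev_metric s) V)"
      then have v: "v \<in> V" and w: "w \<in> V" by auto
      have "sobolev_norm s (F v t - F w t) \<le> 2 * exp (2 * (1 + algebra_const s * R) * T') * sobolev_norm s (v - w)"
        if "t \<in> {-T'..T'}" for t
        using T' F(1)[OF v] F(1)[OF w]
        by (intro solution_stability[OF assms _ _ F(2)[OF v] _ F(2)[OF w] V(1)[OF v] V(1)[OF w] F(3)[OF v] F(3)[OF w] that])
          (auto simp: mspace_sobolev_curves)
      then show "mdist (sobolev_curves s T') (F v) (F w) \<le>
          2 * exp (2 * (1 + algebra_const s * R) * T') * mdist (submetric (sobolev_metric s) V) v w"
        using T' by (subst mdist_sobolev_curves_le[OF F(1)[OF v] F(1)[OF w]]) auto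
    qed
    moreover have "is_solution T' v u \<longleftrightarrow> u = F v" if "v \<in> V" "u \<in> mspace (sobolev_curves s T')" for u v
      using solution_unique[OF assms _ V(1)[OF that(1)] that(2) _ F(1)[OF that(1)] F(2)[OF that(1)]] F(2)[OF that(1)] T'
      by blast
    moreover have "openin (mtopology_of (sobolev_metric s)) V"
      unfolding V_def sobolev_metric_def sobolev.mtopology_of by (rule sobolev.openin_mball)
    moreover have "u\<^sub>0 \<in> V" using u\<^sub>0 by (simp add: V_def sobolev_norm_0)
    ultimately show "\<exists>V U F. V \<subseteq> sobolev_space s \<and>
         openin (mtopology_of (sobolev_metric s)) U \<and> u\<^sub>0 \<in> U \<and> U \<subseteq> V \<and>
         (\<forall>v\<in>V. \<forall>u \<in> mspace (sobolev_curves s T'). is_solution T' v u \<longleftrightarrow> u = F v) \<and>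
         Lipschitz_continuous_map (submetric (sobolev_metric s) V) (sobolev_curves s T') F"
      using V(1) by (intro exI[of _ V] exI[of _ F]) auto
  qed
qed

end
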